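(* Let $n\ge 1$ and let $G$ be a simple edge-coloured graph with $n$ vertices and $n$ colours in which every colour class has size at least $3$. Then $G$ contains a rainbow cycle of length at most $\frac{4n}{9}+7$. Equivalently, $f(n,n,3)\le \frac{4n}{9}+7$.
   Context: Graphs may contain loops and parallel edges. An edge-coloured graph is simple if no colour class (set of edges of one colour) contains two parallel edges. A subgraph is rainbow if no two of its edges have the same colour; a loop is a cycle of length 1 and two parallel edges form a cycle of length 2. $f(n,t,r)$ denotes the maximum length of a shortest rainbow cycle (or $\infty$ if none exists) over all simple edge-coloured graphs with $n$ vertices, at least $t$ colours, and all colour classes of size at least $r$. *)

theory Defs
  imports Complex_Main
begin

text \<open>An edge-coloured multigraph (loops and parallel edges allowed): a finite vertex
set V, a finite edge set E, an endpoint map ends (each edge has one endpoint, a loop,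
or two endpoints) and a colouring col.\<close>

definition ec_graph :: "'v set \<Rightarrow> 'e set \<Rightarrow> ('e \<Rightarrow> 'v set) \<Rightarrow> bool" where
  "ec_graph V E ends \<longleftrightarrow> finite V \<and> finite E \<and>
     (\<forall>e\<in>E. ends e \<subseteq> V \<and> 1 \<le> card (ends e) \<and> card (ends e) \<le> 2)"

definition ec_simple :: "'e set \<Rightarrow> ('e \<Rightarrow> 'v set) \<Rightarrow> ('e \<Rightarrow> 'c) \<Rightarrow> bool" where
  "ec_simple E ends col \<longleftrightarrow>
     (\<forall>e\<in>E. \<forall>f\<in>E. e \<noteq> f \<and> col e = col f \<longrightarrow> ends e \<noteq> ends f)"

definition colour_class :: "'e set \<Rightarrow> ('e \<Rightarrow> 'c) \<Rightarrow> 'c \<Rightarrow> 'e set" where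
  "colour_class E col c = {e \<in> E. col e = c}"

text \<open>A cycle of length k = length es \<ge> 1: distinct vertices vs!0..vs!(k-1), distinct
edges es!0..es!(k-1) with es!i joining vs!i and vs!((i+1) mod k).  For k = 1 this is a
loop, for k = 2 a pair of parallel edges.\<close>
definition is_cycle :: "'v set \<Rightarrow> 'e set \<Rightarrow> ('e \<Rightarrow> 'v set) \<Rightarrow> 'v list \<Rightarrow> 'e list \<Rightarrow> bool" where
  "is_cycle V E ends vs es \<longleftrightarrow>
     length es \<ge> 1 \<and> length vs = length es \<and> distinct vs \<and> distinct es \<and>
     set vs \<subseteq> V \<and> set es \<subseteq> E \<and>
     (\<forall>i < length es. ends (es ! i) = {vs ! i, vs ! ((i + 1) mod length es)})"

definition rainbow :: "('e \<Rightarrow> 'c) \<Rightarrow> 'e list \<Rightarrow> bool" where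
  "rainbow col es \<longleftrightarrow> distinct (map col es)"

end

theory Submission
  imports Defs
begin

text \<open>
  A vertex set \<open>U\<close> has surplus \<open>s\<close> if it spans a rainbow set of \<open>|U| + s\<close> edges.  Contracting a shortest
  cycle shows that \<open>m\<close> vertices of surplus 1 or 2 carry a cycle of length at most \<open>2(m+1)/3\<close> or
  \<open>4(m+2)/7\<close>.  Let \<open>U\<close> be a smallest set of surplus \<open>s\<close>, with \<open>m\<close> vertices and rainbow edge set \<open>A\<close>.
  All but \<open>6s\<close> edges of \<open>A\<close> join vertices of degree 2.  Deleting a vertex of degree 2 and inserting one
  edge keeps the surplus, so by minimality the other edges of the colours of those edges, and all edges
  of the colours not in \<open>A\<close>, leave \<open>U\<close>.

  If surplus 2 occurs, a transversal of all colours that uses such edges has a cycle in which all but 12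
  edges meet the complement of \<open>U\<close>, so its length is at most \<open>2(n-m)+12\<close>; this and \<open>4(m+2)/7\<close> balance at
  \<open>4n/9 + O(1)\<close>.

  If surplus 2 does not occur but some vertex \<open>x\<close> meets no colour class in all of its edges, take
  \<open>U\<close> smallest of surplus 1 in \<open>V - x\<close>.  A degree count in a transversal avoiding \<open>x\<close> bounds by \<open>2(n-1-m)\<close>
  the colours of \<open>A\<close> with another edge avoiding \<open>x\<close>; the remaining ones are not stars, and there are at
  most nine colours that are not stars.  Hence \<open>m \<le> 2n/3 + 4\<close>.

  Otherwise the colour classes are stars, one at each vertex, and the claim is about directed cycles in
  digraphs of out-degree 3.
\<close>

section \<open>Short cycles in graphs with more edges than vertices\<close>

lemma ec_graph_subgraph:
  assumes "ec_graph V E ends" "U \<subseteq> V" "A \<subseteq> E" "\<And>e. e \<in> A \<Longrightarrow> ends e \<subseteq> U"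
  shows "ec_graph U A ends"
  using assms unfolding ec_graph_def by (meson finite_subset subsetD)

lemma is_cycle_mono:
  assumes "is_cycle U A ends vs es" "U \<subseteq> V" "A \<subseteq> E"
  shows "is_cycle V E ends vs es"
  using assms unfolding is_cycle_def by blast

lemma is_cycle_length_le:
  assumes "is_cycle V E ends vs es" "finite V"
  shows "length es \<le> card V"
  using assms unfolding is_cycle_def by (metis card_mono distinct_card)

lemma is_cycle_loop:
  assumes "ec_graph V E ends" "e \<in> E" "card (ends e) \<noteq> 2"
  shows "\<exists>v. is_cycle V E ends [v] [e]"
proof -
  have "ends e \<subseteq> V" "card (ends e) = 1"
    using assms unfolding ec_graph_def by force+
  then obtain v where "ends e = {v}" "v \<in> V"
    by (auto simp: card_1_singleton_iff)
  then show ?thesis using assms(2) by (auto simp: is_cycle_def)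
qed

section \<open>Paths and the existence of cycles\<close>

definition is_path :: "'v set \<Rightarrow> 'e set \<Rightarrow> ('e \<Rightarrow> 'v set) \<Rightarrow> 'v list \<Rightarrow> 'e list \<Rightarrow> bool" where
  "is_path V E ends vs es \<longleftrightarrow>
     length vs = Suc (length es) \<and> distinct vs \<and> set vs \<subseteq> V \<and> set es \<subseteq> E \<and>
     (\<forall>i < length es. ends (es ! i) = {vs ! i, vs ! Suc i})"

lemma is_path_distinct_edges:
  assumes "is_path V E ends vs es"
  shows "distinct es"
  unfolding distinct_conv_nth
proof (intro allI impI notI)
  fix i j assume ij: "i < length es" "j < length es" "i \<noteq> j" "es ! i = es ! j"
  then have "{vs ! i, vs ! Suc i} = {vs ! j, vs ! Suc j}"
    using assms unfolding is_path_def by metis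
  moreover have "vs ! k = vs ! l \<longleftrightarrow> k = l" if "k \<le> length es" "l \<le> length es" for k l
    using assms that unfolding is_path_def by (simp add: nth_eq_iff_index_eq)
  ultimately show False using ij by (auto simp: doubleton_eq_iff)
qed

text \<open>Take a longest path. Its last vertex \<open>v\<close> lies on an edge \<open>f\<close>
  other than the last edge of the path. By maximality the other end of \<open>f\<close> is on the
  path, so \<open>f\<close> closes a tail of the path to a cycle.\<close>

lemma cycle_if_min_degree_2:
  assumes G: "ec_graph V E ends" and "V \<noteq> {}"
    and noloop: "\<And>e. e \<in> E \<Longrightarrow> card (ends e) = 2"
    and deg: "\<And>v. v \<in> V \<Longrightarrow> 2 \<le> card {e \<in> E. v \<in> ends e}"
  shows "\<exists>vs es. is_cycle V E ends vs es"
proof -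
  have fin: "finite V" "finite E" using G by (auto simp: ec_graph_def)
  define P where "P k \<longleftrightarrow> (\<exists>vs es. is_path V E ends vs es \<and> length es = k)" for k
  obtain v0 where "v0 \<in> V" using \<open>V \<noteq> {}\<close> by blast
  then have "P 0" unfolding P_def by (intro exI[of _ "[v0]"] exI[of _ "[]"]) (simp add: is_path_def)
  moreover have bound: "k \<le> card V" if "P k" for k
  proof -
    from that obtain vs es where p: "is_path V E ends vs es" "length es = k" unfolding P_def by blast
    then have "card (set vs) = Suc k" by (simp add: is_path_def distinct_card)
    moreover have "card (set vs) \<le> card V" using p fin by (intro card_mono) (auto simp: is_path_def)
    ultimately show ?thesis by simp
  qed
  ultimately obtain k where "P k" and kmax: "\<And>l. P l \<Longrightarrow> l \<le> k"
    by (metis Nat.ex_has_greatest_nat)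
  then obtain vs es where p: "is_path V E ends vs es" and k: "length es = k" unfolding P_def by blast
  have lvs: "length vs = Suc k" and dvs: "distinct vs" and vsV: "set vs \<subseteq> V" and esE: "set es \<subseteq> E"
    and edge: "\<And>i. i < k \<Longrightarrow> ends (es ! i) = {vs ! i, vs ! Suc i}"
    using p k by (auto simp: is_path_def)
  define v where "v = vs ! k"
  have "v \<in> V" using lvs vsV unfolding v_def by (metis lessI nth_mem subsetD)
  \<comment> \<open>For \<open>k = 0\<close> the term \<open>last es\<close> is unspecified, but
    excluding any single edge leaves another one at \<open>v\<close>, whose degree is at least
    2.\<close>
  have "\<not> {e \<in> E. v \<in> ends e} \<subseteq> {last es}"
  proof
    assume "{e \<in> E. v \<in> ends e} \<subseteq> {last es}"
    then have "card {e \<in> E. v \<in> ends e} \<le> card {last es}" by (intro card_mono) auto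
    then show False using deg[OF \<open>v \<in> V\<close>] by simp
  qed
  then obtain f where f: "f \<in> E" "v \<in> ends f" "f \<noteq> last es" by blast
  obtain w where w: "ends f = {v, w}" "w \<noteq> v"
    using noloop[OF f(1)] f(2) by (auto simp: card_2_iff doubleton_eq_iff)
  have "w \<in> V" using G f(1) w by (auto simp: ec_graph_def)
  have "w \<in> set vs"
  proof (rule ccontr)
    assume "w \<notin> set vs"
    have "is_path V E ends (vs @ [w]) (es @ [f])"
      unfolding is_path_def
    proof (intro conjI allI impI)
      fix i assume "i < length (es @ [f])"
      then consider "i < k" | "i = k" using k by force
      then show "ends ((es @ [f]) ! i) = {(vs @ [w]) ! i, (vs @ [w]) ! Suc i}"
        using edge lvs k w v_def by cases (auto simp: nth_append)
    qed (use lvs k dvs vsV esE \<open>w \<notin> set vs\<close> \<open>w \<in> V\<close> f in auto)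
    then have "P (Suc k)" using k unfolding P_def by fastforce
    then show False using kmax by fastforce
  qed
  then obtain i where i: "i < length vs" "w = vs ! i" by (metis in_set_conv_nth)
  then have "i < k" using w(2) lvs v_def by (cases "i = k") auto
  have fnew: "f \<notin> set es"
  proof
    assume "f \<in> set es"
    then obtain j where j: "j < k" "f = es ! j" using k by (metis in_set_conv_nth)
    have "v \<in> {vs ! j, vs ! Suc j}" using edge j f by metis
    then have "Suc j = k" using j lvs dvs unfolding v_def by (auto simp: nth_eq_iff_index_eq)
    then have "f = last es" using j k by (metis last_conv_nth diff_Suc_1 list.size(3) not_less0)
    then show False using f by simp
  qed
  have "is_cycle V E ends (drop i vs) (drop i es @ [f])"
    unfolding is_cycle_def
  proof (intro conjI allI impI)
    show "distinct (drop i es @ [f])"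
      using is_path_distinct_edges[OF p] fnew by (auto dest: in_set_dropD)
    show "set (drop i vs) \<subseteq> V" using vsV by (meson in_set_dropD subset_iff)
    show "set (drop i es @ [f]) \<subseteq> E" using esE f by (auto dest: in_set_dropD)
    fix j assume "j < length (drop i es @ [f])"
    then consider "j < k - i" | "j = k - i" using k by fastforce
    then show "ends ((drop i es @ [f]) ! j) =
        {drop i vs ! j, drop i vs ! ((j + 1) mod length (drop i es @ [f]))}"
    proof cases
      case 1
      then show ?thesis using edge[of "i + j"] k lvs by (simp add: nth_append)
    next
      case 2
      then show ?thesis using \<open>i < k\<close> k lvs w i v_def by (simp add: nth_append insert_commute)
    qed
  qed (use lvs k dvs \<open>i < k\<close> in auto)
  then show ?thesis by blast
qed

text \<open>Deleting a vertex of degree at most 1 preserves the inequality, so induction reduces to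
  a graph that has a loop or minimum degree 2.\<close>

lemma cycle_if_card_le:
  assumes "ec_graph V E ends" "V \<noteq> {}" "card V \<le> card E"
  shows "\<exists>vs es. is_cycle V E ends vs es"
  using assms
proof (induction "card V" arbitrary: V E rule: less_induct)
  case less
  have fin: "finite V" "finite E" using less.prems by (auto simp: ec_graph_def)
  show ?case
  proof (cases "\<forall>e\<in>E. card (ends e) = 2")
    case False
    then show ?thesis using is_cycle_loop[OF less.prems(1)] by blast
  next
    case noloop: True
    show ?thesis
    proof (cases "\<forall>v\<in>V. 2 \<le> card {e \<in> E. v \<in> ends e}")
      case True
      then show ?thesis using cycle_if_min_degree_2 less.prems noloop by metis
    next
      case False
      then obtain v where v: "v \<in> V" "card {e \<in> E. v \<in> ends e} \<le> 1" by fastforce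
      let ?U = "V - {v}" and ?A = "E - {e \<in> E. v \<in> ends e}"
      have G: "ec_graph ?U ?A ends"
        using less.prems(1) by (rule ec_graph_subgraph) (use less.prems(1) in \<open>auto simp: ec_graph_def\<close>)
      have cU: "card ?U = card V - 1" "card V \<ge> 1"
        using v fin by (auto simp: Suc_le_eq card_gt_0_iff)
      have "card ?A = card E - card {e \<in> E. v \<in> ends e}"
        using fin by (intro card_Diff_subset) auto
      then have le: "card ?U \<le> card ?A" using cU v less.prems(3) by linarith
      \<comment> \<open>Otherwise \<open>V\<close> is a single vertex, and any edge on it would be a
        loop.\<close>
      have "?U \<noteq> {}"
      proof
        assume "?U = {}"
        then have "V = {v}" using v by blast
        then have "E \<noteq> {}" using less.prems(3) by auto
        then obtain e where e: "e \<in> E" by blast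
        then have "ends e \<subseteq> {v}" using less.prems(1) \<open>V = {v}\<close> by (auto simp: ec_graph_def)
        then have "card (ends e) \<le> card {v}" by (intro card_mono) auto
        then show False using noloop e by auto
      qed
      then obtain vs es where "is_cycle ?U ?A ends vs es"
        using less.hyps[OF _ G _ le] cU by (metis diff_less less_le_trans zero_less_one)
      then show ?thesis using is_cycle_mono by (metis Diff_subset)
    qed
  qed
qed


section \<open>Contracting a shortest cycle\<close>

lemma cycle_arc:
  assumes C: "is_cycle V E ends vs es" and "u \<in> set vs" "w \<in> set vs"
  shows "\<exists>C W. C \<subseteq> set es \<and> W \<subseteq> set vs \<and> u \<in> W \<and> w \<in> W \<and> (\<forall>e\<in>C. ends e \<subseteq> W) \<and>
           card W \<le> card C + 1 \<and> 2 * card C \<le> length es"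
proof -
  define g where "g = length es"
  have lvs: "length vs = g" and des: "distinct es"
    and edge: "\<And>i. i < g \<Longrightarrow> ends (es ! i) = {vs ! i, vs ! ((i + 1) mod g)}"
    using C by (auto simp: is_cycle_def g_def)
  have cardC: "card ((!) es ` I) = card I" if "I \<subseteq> {..<g}" for I
    using that des by (intro card_image inj_on_nth) (auto simp: g_def)
  have *: "\<exists>C W. C \<subseteq> set es \<and> W \<subseteq> set vs \<and> vs ! i \<in> W \<and> vs ! j \<in> W \<and> (\<forall>e\<in>C. ends e \<subseteq> W) \<and>
           card W \<le> card C + 1 \<and> 2 * card C \<le> length es" if "i \<le> j" "j < g" for i j
  proof (cases "2 * (j - i) \<le> g")
    case True
    let ?C = "(!) es ` {i..<j}" and ?W = "(!) vs ` {i..j}"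
    have "card ?W \<le> card {i..j}" by (intro card_image_le) simp
    moreover have "card ?C = card {i..<j}" using that by (intro cardC) auto
    moreover have "\<forall>e\<in>?C. ends e \<subseteq> ?W" using edge that by auto
    ultimately show ?thesis
      using that True lvs by (intro exI[of _ ?C] exI[of _ ?W]) (auto simp: g_def)
  next
    case False
    \<comment> \<open>Here the arc from \<open>i\<close> to \<open>j\<close> has more than half of
      the edges, so the complementary arc is taken. It passes through index 0 and is therefore a
      union of two index intervals.\<close>
    let ?I = "{..<i} \<union> {j..<g}"
    let ?C = "(!) es ` ?I" and ?W = "(!) vs ` ({..i} \<union> {j..<g})"
    have "card ?W \<le> card ({..i} \<union> {j..<g})" by (intro card_image_le) simp
    also have "\<dots> \<le> card {..i} + card {j..<g}" by (rule card_Un_le)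
    finally have "card ?W \<le> i + 1 + (g - j)" by simp
    moreover have "card ?C = card ?I" using that by (intro cardC) auto
    moreover have "card ?I = i + (g - j)" using that by (subst card_Un_disjoint) auto
    moreover have "\<forall>e\<in>?C. ends e \<subseteq> ?W"
    proof
      fix e assume "e \<in> ?C"
      then obtain k where "k \<in> ?I" and e: "e = es ! k" by blast
      then have k: "k < i \<or> j \<le> k \<and> k < g" by simp
      have "(k + 1) mod g \<in> {..i} \<union> {j..<g}"
        using k that by (cases "k + 1 = g") auto
      moreover have "k \<in> {..i} \<union> {j..<g}" "k < g" using k that by auto
      ultimately show "ends e \<subseteq> ?W" using e edge[of k] by blast
    qed
    ultimately show ?thesis
      using that False lvs by (intro exI[of _ ?C] exI[of _ ?W]) (auto simp: g_def)
  qed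
  obtain i j where "i < g" "j < g" "u = vs ! i" "w = vs ! j"
    using assms lvs by (metis in_set_conv_nth)
  then show ?thesis using *[of i j] *[of j i] by (metis nle_le)
qed

text \<open>A cycle of the graph with a cycle \<open>C\<close> contracted to the vertex \<open>c\<close> is a cycle or a path with
  its ends on \<open>C\<close>; in the latter case the shorter arc of \<open>C\<close> closes it up.\<close>

lemma cycle_of_contracted_cycle:
  assumes G: "ec_graph V E ends" and C: "is_cycle V E ends vs es" and c: "c \<in> set vs"
    and \<pi>: "\<And>v. \<pi> v = (if v \<in> set vs then c else v)"
    and Q: "is_cycle (\<pi> ` V) (E - set es) (\<lambda>e. \<pi> ` ends e) ws fs"
  shows "\<exists>us hs. is_cycle V E ends us hs \<and> 2 * length hs \<le> 2 * length fs + length es"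
proof -
  define p where "p = length fs"
  have p1: "p \<ge> 1" and lws: "length ws = p" and dws: "distinct ws" and dfs: "distinct fs"
    and wsV: "set ws \<subseteq> \<pi> ` V" and fsE: "set fs \<subseteq> E - set es"
    and edge: "\<And>i. i < p \<Longrightarrow> \<pi> ` ends (fs ! i) = {ws ! i, ws ! ((i + 1) mod p)}"
    using Q by (auto simp: is_cycle_def p_def)
  have ends2: "finite (ends e)" "card (ends e) \<le> 2" if "e \<in> E" for e
    using G that by (auto simp: ec_graph_def intro: finite_subset)
  have ends_ws: "\<pi> ` ends e \<subseteq> set ws" if "e \<in> set fs" for e
  proof -
    obtain i where i: "i < p" "e = fs ! i" using \<open>e \<in> set fs\<close> p_def by (metis in_set_conv_nth)
    then have "(i + 1) mod p < p" by simp
    then show ?thesis using edge[OF i(1)] i lws by auto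
  qed
  \<comment> \<open>\<open>T\<close> collects the vertices at which the edges \<open>fs\<close>
    attach to the contracted cycle. For \<open>p = 1\<close> the only edge may have both ends there;
    for larger \<open>p\<close> each of the at most two edges at \<open>c\<close> has one end
    there.\<close>
  define T where "T = (\<Union>e\<in>set fs. ends e) \<inter> set vs"
  have finT: "finite T" by (simp add: T_def)
  have cardT: "card T \<le> 2"
  proof (cases "p = 1")
    case True
    then obtain e where "fs = [e]" by (metis One_nat_def length_0_conv length_Suc_conv p_def)
    then have "T \<subseteq> ends e" "e \<in> E" using fsE by (auto simp: T_def)
    then show ?thesis using ends2 by (meson card_mono le_trans)
  next
    case False
    define I where "I = {i. i < p \<and> c \<in> {ws ! i, ws ! ((i + 1) mod p)}}"
    have single: "card (ends (fs ! i) \<inter> set vs) \<le> 1" if "i < p" for i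
    proof -
      have e: "fs ! i \<in> E" using that fsE p_def by (metis Diff_iff nth_mem subsetD)
      have "i \<noteq> (i + 1) mod p" using that False by (cases "i + 1 = p") auto
      then have "ws ! i \<noteq> ws ! ((i + 1) mod p)"
        using that dws lws by (simp add: nth_eq_iff_index_eq)
      then have "card (\<pi> ` ends (fs ! i)) = 2" using edge[OF that] by simp
      then have "inj_on \<pi> (ends (fs ! i))"
        using ends2[OF e] by (metis card_image_le eq_card_imp_inj_on le_antisym)
      then have "inj_on \<pi> (ends (fs ! i) \<inter> set vs)" by (rule inj_on_subset) auto
      then have "card (ends (fs ! i) \<inter> set vs) = card (\<pi> ` (ends (fs ! i) \<inter> set vs))"
        by (simp add: card_image)
      also have "\<dots> \<le> card {c}" by (intro card_mono) (auto simp: \<pi>)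
      finally show ?thesis by simp
    qed
    have "card I \<le> 2"
    proof (cases "c \<in> set ws")
      case True
      then obtain k where k: "k < p" "ws ! k = c" using lws by (metis in_set_conv_nth)
      have "I \<subseteq> {k, (k + p - 1) mod p}"
      proof
        fix i assume "i \<in> I"
        then have "i < p" "ws ! i = ws ! k \<or> ws ! ((i + 1) mod p) = ws ! k"
          using k by (auto simp: I_def)
        moreover have "(i + 1) mod p < p" using k by simp
        ultimately have i: "i < p" "i = k \<or> (i + 1) mod p = k"
          using k dws lws by (metis nth_eq_iff_index_eq)+
        then show "i \<in> {k, (k + p - 1) mod p}" by (cases "i + 1 = p") auto
      qed
      then have "card I \<le> card {k, (k + p - 1) mod p}" by (intro card_mono) auto
      also have "\<dots> \<le> 2" by (simp add: card_insert_if)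
      finally show ?thesis .
    next
      case False
      then have "ws ! i \<noteq> c" if "i < p" for i using that lws by auto
      moreover have "(i + 1) mod p < p" for i using p1 by simp
      ultimately have "I = {}" by (auto simp: I_def)
      then show ?thesis by simp
    qed
    have "T \<subseteq> (\<Union>i\<in>I. ends (fs ! i) \<inter> set vs)"
    proof
      fix v assume "v \<in> T"
      then obtain i where i: "i < p" "v \<in> ends (fs ! i)" "v \<in> set vs"
        by (auto simp: T_def in_set_conv_nth p_def)
      then have "c \<in> \<pi> ` ends (fs ! i)" by (auto simp: \<pi> image_iff intro!: bexI[of _ v])
      then have "i \<in> I" using edge[OF i(1)] i by (simp add: I_def)
      then show "v \<in> (\<Union>i\<in>I. ends (fs ! i) \<inter> set vs)" using i by blast
    qed
    then have "card T \<le> card (\<Union>i\<in>I. ends (fs ! i) \<inter> set vs)"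
      by (intro card_mono) (auto simp: I_def)
    also have "\<dots> \<le> (\<Sum>i\<in>I. card (ends (fs ! i) \<inter> set vs))"
      by (intro card_UN_le) (auto simp: I_def)
    also have "\<dots> \<le> (\<Sum>i\<in>I. 1)" using single by (intro sum_mono) (auto simp: I_def)
    also have "\<dots> \<le> 2" using \<open>card I \<le> 2\<close> by simp
    finally show ?thesis .
  qed
  obtain D W where D: "D \<subseteq> set es" "\<forall>e\<in>D. ends e \<subseteq> W" "2 * card D \<le> length es"
    and W: "W \<subseteq> set vs" "T \<subseteq> W" "card W + card (set ws - {c}) \<le> card D + p"
  proof (cases "c \<in> set ws")
    case True
    obtain u w where uw: "T \<subseteq> {u, w}" "u \<in> set vs" "w \<in> set vs"
    proof -
      consider "card T = 0" | "card T = 1" | "card T = 2" using cardT by linarith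
      then show thesis
      proof cases
        case 1
        then show thesis using that[of c c] c finT by simp
      next
        case 2
        then obtain a where "T = {a}" by (auto simp: card_1_singleton_iff)
        then show thesis using that[of a a] by (auto simp: T_def)
      next
        case 3
        then obtain a b where "T = {a, b}" by (auto simp: card_2_iff)
        then show thesis using that[of a b] by (auto simp: T_def)
      qed
    qed
    obtain D W where DW: "D \<subseteq> set es" "W \<subseteq> set vs" "u \<in> W" "w \<in> W" "\<forall>e\<in>D. ends e \<subseteq> W"
      "card W \<le> card D + 1" "2 * card D \<le> length es"
      using cycle_arc[OF C uw(2,3)] by blast
    have "card (set ws - {c}) = p - 1" using True dws lws by (simp add: distinct_card)
    then have "card W + card (set ws - {c}) \<le> card D + p" using DW(6) p1 by simp
    then show thesis using that[of D W] DW uw by blast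
  next
    case False
    have "T = {}"
    proof (rule ccontr)
      assume "T \<noteq> {}"
      then obtain e v where ev: "e \<in> set fs" "v \<in> ends e" "v \<in> set vs" unfolding T_def by blast
      then have "c \<in> \<pi> ` ends e" by (auto simp: \<pi> image_iff intro!: bexI[of _ v])
      then show False using ends_ws[OF ev(1)] False by blast
    qed
    then show thesis using that[of "{}" "{}"] False dws lws by (simp add: distinct_card)
  qed
  \<comment> \<open>The new cycle is not traced explicitly: \<open>?A\<close> has
    \<open>p + card D\<close> edges on at most that many vertices, so it contains a cycle, whose
    length is at most \<open>p + card D\<close>.\<close>
  let ?U = "(set ws - {c}) \<union> W" and ?A = "set fs \<union> D"
  have "?U \<subseteq> V"
  proof -
    have "set ws - {c} \<subseteq> V" using wsV by (auto simp: \<pi> split: if_splits)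
    moreover have "W \<subseteq> V" using W C by (auto simp: is_cycle_def)
    ultimately show ?thesis by blast
  qed
  moreover have "ends e \<subseteq> ?U" if "e \<in> ?A" for e
  proof (cases "e \<in> D")
    case True
    then show ?thesis using D by blast
  next
    case False
    then have e: "e \<in> set fs" using that by blast
    show ?thesis
    proof
      fix v assume v: "v \<in> ends e"
      show "v \<in> ?U"
      proof (cases "v \<in> set vs")
        case True
        then show ?thesis using v e W by (auto simp: T_def)
      next
        case False
        then have "v = \<pi> v" "v \<noteq> c" using c by (auto simp: \<pi>)
        then show ?thesis using ends_ws[OF e] v by blast
      qed
    qed
  qed
  moreover have AE: "?A \<subseteq> E" using fsE D C by (auto simp: is_cycle_def)
  ultimately have G': "ec_graph ?U ?A ends" by (intro ec_graph_subgraph[OF G])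
  have "card ?A = p + card D"
    using fsE D dfs by (subst card_Un_disjoint) (auto simp: distinct_card p_def intro: finite_subset)
  moreover have "card ?U \<le> card (set ws - {c}) + card W" by (rule card_Un_le)
  ultimately have le: "card ?U \<le> card ?A" "card ?U \<le> p + card D" using W(3) by linarith+
  have "?U \<noteq> {}"
  proof
    assume "?U = {}"
    moreover have "fs ! 0 \<in> ?A" using p1 p_def by (metis UnI1 less_le_trans nth_mem zero_less_one)
    ultimately have "ends (fs ! 0) = {}" using \<open>\<And>e. e \<in> ?A \<Longrightarrow> ends e \<subseteq> ?U\<close> by blast
    then show False using edge[of 0] p1 by simp
  qed
  then obtain us hs where uh: "is_cycle ?U ?A ends us hs" using cycle_if_card_le G' le(1) by blast
  moreover have "finite ?U" using G' by (simp add: ec_graph_def)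
  ultimately have "length hs \<le> p + card D" using is_cycle_length_le le(2) by (metis le_trans)
  then have "2 * length hs \<le> 2 * length fs + length es" using D(3) p_def by linarith
  then show ?thesis using is_cycle_mono[OF uh \<open>?U \<subseteq> V\<close> AE] by blast
qed

text \<open>Contracting a cycle of length g removes g edges and g - 1 vertices, so edges minus
  vertices drops by one. A quotient cycle shorter than g/2 would lift, together with an arc of
  length at most g/2, to a cycle shorter than g.\<close>

lemma contract_shortest_cycle:
  fixes V :: "'v set"
  assumes G: "ec_graph V E ends" and C: "is_cycle V E ends vs es"
    and short: "\<forall>us hs. is_cycle V E ends us hs \<longrightarrow> length es \<le> length hs"
  obtains V' :: "'v set" and ends' where "ec_graph V' (E - set es) ends'" "V' \<noteq> {}"
    "card V' + length es = card V + 1"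
    "\<And>ws fs. is_cycle V' (E - set es) ends' ws fs \<Longrightarrow> length es \<le> 2 * length fs"
proof -
  have fin: "finite V" "finite E" using G by (auto simp: ec_graph_def)
  have vs: "set vs \<subseteq> V" "distinct vs" "length vs = length es" "length es \<ge> 1"
    using C by (auto simp: is_cycle_def)
  then obtain c where c: "c \<in> set vs" by (metis length_0_conv not_one_le_zero all_not_in_conv set_empty)
  define \<pi> where "\<pi> v = (if v \<in> set vs then c else v)" for v
  have V': "\<pi> ` V = insert c (V - set vs)" using c vs by (auto simp: \<pi>_def)
  have "card (V - set vs) + length es = card V"
    using card_Diff_subset[of "set vs" V] card_mono[OF fin(1) vs(1)] distinct_card[OF vs(2)] vs by simp
  then have cV': "card (\<pi> ` V) + length es = card V + 1"
    using V' fin c by simp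
  have "ec_graph (\<pi> ` V) (E - set es) (\<lambda>e. \<pi> ` ends e)"
    unfolding ec_graph_def
  proof (intro conjI ballI)
    fix e assume "e \<in> E - set es"
    then have e: "ends e \<subseteq> V" "1 \<le> card (ends e)" "card (ends e) \<le> 2" "finite (ends e)"
      using G fin by (auto simp: ec_graph_def intro: finite_subset)
    show "\<pi> ` ends e \<subseteq> \<pi> ` V" using e by blast
    show "1 \<le> card (\<pi> ` ends e)" using e by (metis One_nat_def Suc_leI card_gt_0_iff finite_imageI image_is_empty not_one_le_zero card.empty)
    show "card (\<pi> ` ends e) \<le> 2" using e card_image_le le_trans by blast
  qed (use fin in auto)
  moreover have "length es \<le> 2 * length fs"
    if Q: "is_cycle (\<pi> ` V) (E - set es) (\<lambda>e. \<pi> ` ends e) ws fs" for ws fs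
    using cycle_of_contracted_cycle[OF G C c \<pi>_def Q] short by fastforce
  ultimately show thesis using that cV' V' by blast
qed

lemma obtain_shortest_cycle:
  assumes "\<exists>vs es. is_cycle V E ends vs es"
  obtains vs es where "is_cycle V E ends vs es"
    "\<forall>us hs. is_cycle V E ends us hs \<longrightarrow> length es \<le> length hs"
proof -
  let ?P = "\<lambda>p. is_cycle V E ends (fst p) (snd p)"
  obtain p where "?P p" using assms by auto
  then obtain q where "?P q" "\<forall>r. ?P r \<longrightarrow> length (snd q) \<le> length (snd r)"
    using ex_has_least_nat[of ?P p "\<lambda>p. length (snd p)"] by blast
  then show thesis using that[of "fst q" "snd q"] by (metis fst_conv snd_conv)
qed

text \<open>Let g be the length of a shortest cycle and m the number of vertices. The quotient has m
  + 1 - g vertices and at least as many edges, hence a cycle of length at most m + 1 - g; as this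
  length is at least g/2, 3g is at most 2(m + 1).\<close>

lemma short_cycle_surplus_1:
  fixes V :: "'v set"
  assumes G: "ec_graph V E ends" and "V \<noteq> {}" and card: "card V + 1 \<le> card E"
  shows "\<exists>vs es. is_cycle V E ends vs es \<and> 3 * length es \<le> 2 * (card V + 1)"
proof -
  have "\<exists>vs es. is_cycle V E ends vs es" using cycle_if_card_le assms by (metis add_leD1)
  then obtain vs es where C: "is_cycle V E ends vs es"
    and short: "\<forall>us hs. is_cycle V E ends us hs \<longrightarrow> length es \<le> length hs"
    by (rule obtain_shortest_cycle) blast
  obtain V' :: "'v set" and ends' where Q: "ec_graph V' (E - set es) ends'" "V' \<noteq> {}"
    "card V' + length es = card V + 1"
    "\<And>ws fs. is_cycle V' (E - set es) ends' ws fs \<Longrightarrow> length es \<le> 2 * length fs"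
    using contract_shortest_cycle[OF G C short] by blast
  have "card (E - set es) = card E - length es"
    using C by (subst card_Diff_subset) (auto simp: is_cycle_def distinct_card)
  then have "card V' \<le> card (E - set es)" using Q(3) card by linarith
  then obtain ws fs where q: "is_cycle V' (E - set es) ends' ws fs"
    using cycle_if_card_le[OF Q(1,2)] by blast
  then have "length fs \<le> card V'" using Q(1) is_cycle_length_le by (metis ec_graph_def)
  then have "3 * length es \<le> 2 * (card V + 1)" using Q(4)[OF q] Q(3) by simp
  then show ?thesis using C by blast
qed

text \<open>The quotient by a shortest cycle, of length g, has surplus 1 and so a cycle of length at
  most 2(m + 2 - g)/3, where m is the number of vertices. This length is at least g/2, whence 7g is
  at most 4(m + 2).\<close>

lemma short_cycle_surplus_2:
  fixes V :: "'v set"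
  assumes G: "ec_graph V E ends" and "V \<noteq> {}" and card: "card V + 2 \<le> card E"
  shows "\<exists>vs es. is_cycle V E ends vs es \<and> 7 * length es \<le> 4 * (card V + 2)"
proof -
  have "\<exists>vs es. is_cycle V E ends vs es" using cycle_if_card_le assms by (metis add_leD1)
  then obtain vs es where C: "is_cycle V E ends vs es"
    and short: "\<forall>us hs. is_cycle V E ends us hs \<longrightarrow> length es \<le> length hs"
    by (rule obtain_shortest_cycle) blast
  obtain V' :: "'v set" and ends' where Q: "ec_graph V' (E - set es) ends'" "V' \<noteq> {}"
    "card V' + length es = card V + 1"
    "\<And>ws fs. is_cycle V' (E - set es) ends' ws fs \<Longrightarrow> length es \<le> 2 * length fs"
    using contract_shortest_cycle[OF G C short] by blast
  have "card (E - set es) = card E - length es"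
    using C by (subst card_Diff_subset) (auto simp: is_cycle_def distinct_card)
  then have "card V' + 1 \<le> card (E - set es)" using Q(3) card by linarith
  then obtain ws fs where q: "is_cycle V' (E - set es) ends' ws fs"
    "3 * length fs \<le> 2 * (card V' + 1)"
    using short_cycle_surplus_1[OF Q(1,2)] by blast
  have "7 * length es \<le> 4 * (card V + 2)" using Q(4)[OF q(1)] q(2) Q(3) by simp
  then show ?thesis using C by blast
qed

section \<open>Short closed walks in digraphs of out-degree three\<close>

definition arcs :: "'v set \<Rightarrow> ('v \<Rightarrow> 'v set) \<Rightarrow> 'v rel" where
  "arcs V N = {(u, v). u \<in> V \<and> v \<in> N u}"

lemma relpow_one_arc: "(u, v) \<in> (R :: 'v rel) \<Longrightarrow> (u, v) \<in> R ^^ 1"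
  by auto

lemma relpow_join: "(a, b) \<in> R ^^ i \<Longrightarrow> (b, c) \<in> R ^^ j \<Longrightarrow> (a, c) \<in> R ^^ (i + j)"
  by (auto simp: relpow_add)

text \<open>A walk that uses arcs outside \<open>R\<close> is cut before the first and after the last of them.\<close>

lemma relpow_with_shortcuts:
  assumes "(a, b) \<in> S ^^ k" "S \<subseteq> R \<union> Q \<times> T"
  shows "(a, b) \<in> R ^^ k \<or>
    (\<exists>u\<in>Q. \<exists>t\<in>T. \<exists>i j. i + j < k \<and> (a, u) \<in> R ^^ i \<and> (t, b) \<in> R ^^ j)"
  using assms(1)
proof (induction k arbitrary: b)
  case 0
  then show ?case by simp
next
  case (Suc k)
  then obtain c where c: "(a, c) \<in> S ^^ k" "(c, b) \<in> S" by auto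
  from Suc.IH[OF c(1)] show ?case
  proof
    assume ac: "(a, c) \<in> R ^^ k"
    show ?thesis
    proof (cases "(c, b) \<in> R")
      case True
      then show ?thesis using ac by auto
    next
      case False
      then have "c \<in> Q" "b \<in> T" using c assms(2) by auto
      then show ?thesis using ac by (metis add.right_neutral lessI relpow_0_I)
    qed
  next
    assume "\<exists>u\<in>Q. \<exists>t\<in>T. \<exists>i j. i + j < k \<and> (a, u) \<in> R ^^ i \<and> (t, c) \<in> R ^^ j"
    then obtain u t i j where *: "u \<in> Q" "t \<in> T" "i + j < k" "(a, u) \<in> R ^^ i" "(t, c) \<in> R ^^ j"
      by blast
    show ?thesis
    proof (cases "(c, b) \<in> R")
      case True
      then have "(t, b) \<in> R ^^ Suc j" using * by auto
      then show ?thesis using * by (metis Suc_mono add_Suc_right)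
    next
      case False
      then have "b \<in> T" using c assms(2) by auto
      then show ?thesis using * by (metis add.right_neutral add_lessD1 less_SucI relpow_0_I)
    qed
  qed
qed

text \<open>If each of the three out-neighbours of \<open>u\<close> had an out-neighbour among them,
  they would carry a closed walk of at most three steps. So some \<open>y\<close> in
  \<open>N u\<close> has \<open>N y\<close> disjoint from \<open>N u\<close>, and \<open>u\<close>
  lies in neither set: 1 + 3 + 3 vertices.\<close>

lemma card_two_step_ball:
  assumes N: "\<And>v. v \<in> V \<Longrightarrow> N v \<subseteq> V \<and> card (N v) = 3" and u: "u \<in> V"
    and nc: "\<And>v k. 1 \<le> k \<Longrightarrow> k \<le> 3 \<Longrightarrow> (v, v) \<notin> arcs V N ^^ k"
  shows "7 \<le> card (insert u (N u \<union> (\<Union>y\<in>N u. N y)))"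
proof -
  let ?R = "arcs V N"
  have fin: "finite (N v)" if "v \<in> V" for v using N[OF that] by (metis card.infinite zero_neq_numeral)
  have R: "(a, b) \<in> ?R" if "a \<in> V" "b \<in> N a" for a b using that by (simp add: arcs_def)
  have c1: "(a, a) \<notin> ?R" for a using nc[of 1 a] relpow_one_arc by auto
  have c2: "(b, a) \<notin> ?R" if "(a, b) \<in> ?R" for a b
    using nc[of 2 a] that by (auto simp: numeral_2_eq_2)
  have c3: "(c, a) \<notin> ?R" if "(a, b) \<in> ?R" "(b, c) \<in> ?R" for a b c
    using nc[of 3 a] that by (auto simp: numeral_3_eq_3)
  have "\<exists>y\<in>N u. N y \<inter> N u = {}"
  proof (rule ccontr)
    assume "\<not> ?thesis"
    then have suc: "\<exists>z\<in>N u. (y, z) \<in> ?R" if "y \<in> N u" for y using that N[OF u] R by blast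
    obtain a b c where "N u = {a, b, c}" using N[OF u] by (auto simp: card_3_iff)
    then show False using suc[of a] suc[of b] suc[of c] c1 c2 c3 by (metis insertE insertI1 insertI2 singletonD)
  qed
  then obtain y where y: "y \<in> N u" "N y \<inter> N u = {}" by blast
  have yV: "y \<in> V" using y N[OF u] by blast
  have "u \<notin> N u" using c1 R[OF u] by blast
  moreover have "u \<notin> N y" using c2 R[OF u y(1)] R[OF yV] by blast
  ultimately have "card (insert u (N u \<union> N y)) = 7"
    using y N[OF u] N[OF yV] fin[OF u] fin[OF yV] by (simp add: card_Un_disjoint Int_commute)
  moreover have "card (insert u (N u \<union> N y)) \<le> card (insert u (N u \<union> (\<Union>y\<in>N u. N y)))"
    using y N[OF u] fin u by (intro card_mono) (auto intro!: fin)
  ultimately show ?thesis by simp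
qed

text \<open>Some vertex \<open>v\<close> is reached in at most two steps from a set \<open>B\<close> of seven vertices.  Delete \<open>B\<close>
  and let every vertex with an arc into \<open>B\<close> point to the out-neighbours of \<open>v\<close> instead: a closed walk
  of the smaller digraph lifts at the cost of three arcs, and 3/7 is less than 4/9.\<close>

lemma short_closed_walk:
  assumes "finite V" "V \<noteq> {}" "\<And>v. v \<in> V \<Longrightarrow> N v \<subseteq> V \<and> card (N v) = 3"
  shows "\<exists>v k. 1 \<le> k \<and> 9 * k \<le> 4 * card V + 63 \<and> (v, v) \<in> arcs V N ^^ k"
  using assms
proof (induction "card V" arbitrary: V N rule: less_induct)
  case less
  note fin = less.prems(1) and N = less.prems(3)
  let ?R = "arcs V N"
  show ?case
  proof (rule ccontr)
    assume neg: "\<not> ?case"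
    \<comment> \<open>As 63 is 9 times 7, a closed walk of at most 7 steps would satisfy the claim
      at once.\<close>
    then have nc: "(v, v) \<notin> ?R ^^ k" if "1 \<le> k" "k \<le> 7" for v k using that by fastforce
    define P where "P u = insert u (N u \<union> (\<Union>y\<in>N u. N y))" for u
    define B where "B v = {u \<in> V. v \<in> P u}" for v
    have PV: "P u \<subseteq> V" if "u \<in> V" for u using that N unfolding P_def by blast
    have "7 \<le> card (P u)" if "u \<in> V" for u
      unfolding P_def by (rule card_two_step_ball[OF N that]) (use nc in auto)
    \<comment> \<open>Counting the pairs with \<open>v \<in> P u\<close> in both ways shows that the
      sets \<open>B v\<close> have average size at least 7.\<close>
    then have "(\<Sum>u\<in>V. 7) \<le> (\<Sum>u\<in>V. card (P u))" by (intro sum_mono) auto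
    also have "\<dots> = (\<Sum>u\<in>V. \<Sum>v\<in>V. if v \<in> P u then 1 else 0)"
      using PV fin by (intro sum.cong) (auto simp: sum.If_cases Int_absorb1)
    also have "\<dots> = (\<Sum>v\<in>V. \<Sum>u\<in>V. if v \<in> P u then 1 else 0)" by (rule sum.swap)
    also have "\<dots> = (\<Sum>v\<in>V. card (B v))"
      using fin by (intro sum.cong) (auto simp: sum.If_cases B_def Int_def)
    finally have "(\<Sum>u\<in>V. 7) \<le> (\<Sum>v\<in>V. card (B v))" .
    then obtain v where v: "v \<in> V" "7 \<le> card (B v)"
      using sum_strict_mono[OF fin less.prems(2), of "\<lambda>v. card (B v)" "\<lambda>_. 7"] by (meson leD not_le)
    have reach: "\<exists>d\<le>2. (b, v) \<in> ?R ^^ d" if "b \<in> B v" for b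
    proof -
      have b: "b \<in> V" "v \<in> P b" using that by (auto simp: B_def)
      then consider "v = b" | "v \<in> N b" | y where "y \<in> N b" "v \<in> N y" by (auto simp: P_def)
      then show ?thesis
      proof cases
        case 1
        then show ?thesis by (intro exI[of _ 0]) simp
      next
        case 2
        then show ?thesis using b by (intro exI[of _ 1]) (simp add: arcs_def relpow_one_arc del: One_nat_def)
      next
        case 3
        then have "(b, y) \<in> ?R" "(y, v) \<in> ?R" using b N[OF b(1)] by (auto simp: arcs_def)
        then show ?thesis by (intro exI[of _ 2]) (auto simp: numeral_2_eq_2)
      qed
    qed
    have vT: "(v, t) \<in> ?R" if "t \<in> N v" for t using that v by (simp add: arcs_def)
    \<comment> \<open>This keeps the redirected arcs inside the smaller digraph. An out-neighbour of
      \<open>v\<close> in \<open>B v\<close> would give a closed walk of at most three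
      steps.\<close>
    have disj: "N v \<inter> B v = {}"
    proof (rule ccontr)
      assume "N v \<inter> B v \<noteq> {}"
      then obtain t d where t: "t \<in> N v" "d \<le> 2" "(t, v) \<in> ?R ^^ d" using reach by blast
      then have "(v, v) \<in> ?R ^^ (1 + d)" using relpow_join relpow_one_arc vT by metis
      then show False using nc[of "1 + d" v] t by simp
    qed
    define V' where "V' = V - B v"
    define N' where "N' u = (if N u \<inter> B v = {} then N u else N v)" for u
    have BV: "B v \<subseteq> V" by (auto simp: B_def)
    have NvV': "N v \<subseteq> V'" using N[OF v(1)] disj by (auto simp: V'_def)
    have N': "N' u \<subseteq> V' \<and> card (N' u) = 3" if "u \<in> V'" for u
      using that N[of u] N[OF v(1)] NvV' by (auto simp: V'_def N'_def)
    have ne: "V' \<noteq> {}" using NvV' N[OF v(1)] by fastforce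
    have cV: "card V' + card (B v) = card V"
      using BV fin card_mono[OF fin BV] by (simp add: V'_def card_Diff_subset finite_subset)
    then have lt: "card V' < card V" using v(2) by linarith
    obtain x k where xk: "1 \<le> k" "9 * k \<le> 4 * card V' + 63" "(x, x) \<in> arcs V' N' ^^ k"
      using less.hyps[of V' N'] lt fin ne N' by (metis V'_def finite_Diff)
    let ?Q = "{u \<in> V. N u \<inter> B v \<noteq> {}}"
    have "arcs V' N' \<subseteq> ?R \<union> ?Q \<times> N v" by (auto simp: arcs_def V'_def N'_def split: if_splits)
    from relpow_with_shortcuts[OF xk(3) this] show False
    proof
      assume "(x, x) \<in> ?R ^^ k"
      moreover have "9 * k \<le> 4 * card V + 63" using xk(2) lt by linarith
      ultimately show False using neg xk(1) by blast
    next
      assume "\<exists>u\<in>?Q. \<exists>t\<in>N v. \<exists>i j. i + j < k \<and> (x, u) \<in> ?R ^^ i \<and> (t, x) \<in> ?R ^^ j"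
      then obtain u t i j b where *: "u \<in> V" "b \<in> N u" "b \<in> B v" "t \<in> N v" "i + j < k"
        "(x, u) \<in> ?R ^^ i" "(t, x) \<in> ?R ^^ j" by blast
      obtain d where d: "d \<le> 2" "(b, v) \<in> ?R ^^ d" using reach[OF *(3)] by blast
      have "(u, b) \<in> ?R ^^ 1" using * by (intro relpow_one_arc) (simp add: arcs_def)
      moreover have "(v, t) \<in> ?R ^^ 1" using vT * by (intro relpow_one_arc)
      \<comment> \<open>The closed walk runs from \<open>t\<close> to \<open>x\<close>,
        \<open>u\<close>, \<open>b\<close>, \<open>v\<close> and back to \<open>t\<close>. Since
        \<open>i + j < k\<close> and \<open>d\<close> is at most 2, it has at most
        \<open>k + 3\<close> steps; the extra 27 is paid for by the deleted vertices, which number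
        at least 7 and contribute at least 28.\<close>
      ultimately have "(t, t) \<in> ?R ^^ (j + i + 1 + d + 1)" using * d relpow_join by meson
      moreover have "9 * (j + i + 1 + d + 1) \<le> 4 * card V + 63"
      proof -
        have "j + i + 1 + d + 1 \<le> k + 3" using d(1) *(5) by linarith
        then have "9 * (j + i + 1 + d + 1) \<le> 9 * k + 27" by simp
        then show ?thesis using xk(2) cV v(2) by linarith
      qed
      ultimately show False using neg by (metis le_add2)
    qed
  qed
qed

text \<open>A shortest closed walk repeats no vertex, since the piece between two visits would be a
  shorter closed walk.\<close>

lemma short_directed_cycle:
  assumes "finite V" "V \<noteq> {}" "\<And>v. v \<in> V \<Longrightarrow> N v \<subseteq> V \<and> card (N v) = 3"
  shows "\<exists>k f. 1 \<le> k \<and> 9 * k \<le> 4 * card V + 63 \<and> inj_on f {..<k} \<and> f k = f 0 \<and>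
    (\<forall>i<k. f i \<in> V \<and> f (Suc i) \<in> N (f i))"
proof -
  let ?P = "\<lambda>k. 1 \<le> k \<and> (\<exists>v. (v, v) \<in> arcs V N ^^ k)"
  obtain l where l: "?P l" "9 * l \<le> 4 * card V + 63" using short_closed_walk[of V N] assms by blast
  define k where "k = (LEAST k. ?P k)"
  have k: "?P k" unfolding k_def using l(1) by (rule LeastI)
  have min: "k \<le> j" if "?P j" for j unfolding k_def using that by (rule Least_le)
  obtain f where f: "f 0 = f k" "\<And>i. i < k \<Longrightarrow> (f i, f (Suc i)) \<in> arcs V N"
    using k by (metis relpow_fun_conv)
  have "f i \<noteq> f j" if "i < j" "j < k" for i j
  proof
    assume eq: "f i = f j"
    have "(f i, f j) \<in> arcs V N ^^ (j - i)"
      unfolding relpow_fun_conv using that f(2) by (intro exI[of _ "\<lambda>l. f (i + l)"]) auto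
    then have "?P (j - i)" using eq that by auto
    then have "k \<le> j - i" by (rule min)
    then show False using that by linarith
  qed
  then have "inj_on f {..<k}" by (metis inj_onI lessThan_iff linorder_neqE_nat)
  moreover have "9 * k \<le> 4 * card V + 63" using min[OF l(1)] l(2) by linarith
  ultimately show ?thesis using k f by (intro exI[of _ k] exI[of _ f]) (auto simp: arcs_def)
qed

section \<open>Rainbow cycles\<close>

lemma card_Diff_plus: "finite A \<Longrightarrow> B \<subseteq> A \<Longrightarrow> card (A - B) + card B = card A"
  by (metis card_Diff_subset card_mono finite_subset le_add_diff_inverse2)

lemma sum_degrees:
  assumes "finite X" "finite A"
  shows "(\<Sum>v\<in>X. card {e \<in> A. v \<in> ends e}) = (\<Sum>e\<in>A. card (ends e \<inter> X))"
proof -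
  have "(\<Sum>v\<in>X. card {e \<in> A. v \<in> ends e}) = (\<Sum>v\<in>X. \<Sum>e\<in>A. if v \<in> ends e then 1 else 0)"
    using assms by (intro sum.cong) (auto simp: sum.If_cases Int_def)
  also have "\<dots> = (\<Sum>e\<in>A. \<Sum>v\<in>X. if v \<in> ends e then 1 else 0)" by (rule sum.swap)
  also have "\<dots> = (\<Sum>e\<in>A. card (ends e \<inter> X))"
    using assms by (intro sum.cong) (auto simp: sum.If_cases Int_def conj_commute)
  finally show ?thesis .
qed

lemma card_edges_meeting_le:
  assumes "finite X" "finite A"
  shows "card {e \<in> A. ends e \<inter> X \<noteq> {}} \<le> (\<Sum>v\<in>X. card {e \<in> A. v \<in> ends e})"
proof -
  have "{e \<in> A. ends e \<inter> X \<noteq> {}} = (\<Union>v\<in>X. {e \<in> A. v \<in> ends e})" by blast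
  then show ?thesis using assms by (simp add: card_UN_le)
qed

text \<open>A vertex lies on at most two edges of a cycle, so at most \<open>2 * card X\<close> of
  the edges meet \<open>X\<close>.\<close>

lemma cycle_length_le_cover:
  assumes C: "is_cycle V E ends vs es" and fin: "finite F" "finite X"
    and cov: "\<And>e. e \<in> set es \<Longrightarrow> e \<in> F \<or> ends e \<inter> X \<noteq> {}"
  shows "length es \<le> card F + 2 * card X"
proof -
  define l where "l = length es"
  have lvs: "length vs = l" and l1: "l \<ge> 1" and d: "distinct vs" "distinct es"
    and edge: "\<And>i. i < l \<Longrightarrow> ends (es ! i) = {vs ! i, vs ! ((i + 1) mod l)}"
    using C by (auto simp: is_cycle_def l_def)
  define I where "I = {i. i < l \<and> es ! i \<in> F}"
  define J where "J = {i. i < l \<and> vs ! i \<in> X}"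
  \<comment> \<open>Edge \<open>i\<close> joins vertices \<open>i\<close> and \<open>i + 1\<close>
    modulo \<open>l\<close>, so it meets \<open>X\<close> if \<open>i\<close> is in \<open>J\<close>
    or is the cyclic predecessor of an element of \<open>J\<close>.\<close>
  let ?J' = "(\<lambda>i. (i + l - 1) mod l) ` J"
  have "card I \<le> card F"
    using fin d by (intro card_inj_on_le[of "(!) es"] inj_on_nth) (auto simp: I_def l_def)
  moreover have "card J \<le> card X"
    using fin d lvs by (intro card_inj_on_le[of "(!) vs"] inj_on_nth) (auto simp: J_def)
  moreover have "{..<l} \<subseteq> I \<union> (J \<union> ?J')"
  proof
    fix i assume "i \<in> {..<l}"
    then have i: "i < l" by simp
    then have "es ! i \<in> F \<or> vs ! i \<in> X \<or> vs ! ((i + 1) mod l) \<in> X"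
      using cov[of "es ! i"] edge[OF i] by (auto simp: l_def)
    moreover have "i = ((i + 1) mod l + l - 1) mod l" using i by (cases "i + 1 = l") auto
    moreover have "(i + 1) mod l < l" using l1 by simp
    ultimately show "i \<in> I \<union> (J \<union> ?J')" using i unfolding I_def J_def by blast
  qed
  then have "card {..<l} \<le> card (I \<union> (J \<union> ?J'))"
    by (intro card_mono) (auto simp: I_def J_def)
  moreover have "card (I \<union> (J \<union> ?J')) \<le> card I + (card J + card J)"
    using card_Un_le[of I "J \<union> ?J'"] card_Un_le[of J ?J'] card_image_le[of J "\<lambda>i. (i + l - 1) mod l"]
    by (simp add: J_def)
  ultimately show ?thesis by (simp add: l_def)
qed

section \<open>Rainbow edge sets with surplus in a counterexample\<close>

locale rainbow_counterexample =
  fixes V :: "'v set" and E :: "'e set" and ends :: "'e \<Rightarrow> 'v set" and col :: "'e \<Rightarrow> 'c"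
  assumes G: "ec_graph V E ends" and simple: "ec_simple E ends col" and ne: "V \<noteq> {}"
    and ncol: "card (col ` E) = card V"
    and class_ge: "\<And>c. c \<in> col ` E \<Longrightarrow> 3 \<le> card (colour_class E col c)"
    and no_short: "\<And>vs es. is_cycle V E ends vs es \<Longrightarrow> rainbow col es \<Longrightarrow> 4 * card V + 63 < 9 * length es"
begin

lemma finV: "finite V" and finE: "finite E"
  using G by (auto simp: ec_graph_def)

lemma ends_subset: "e \<in> E \<Longrightarrow> ends e \<subseteq> V"
  using G by (auto simp: ec_graph_def)

text \<open>The negated bound, multiplied by 9 to stay in the natural numbers, excludes rainbow
  cycles of length up to 7, and a loop is one of length 1.\<close>

lemma card_ends: "e \<in> E \<Longrightarrow> card (ends e) = 2"
  using is_cycle_loop[OF G] no_short by (fastforce simp: rainbow_def)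

lemma fin_ends: "e \<in> E \<Longrightarrow> finite (ends e)"
  using ends_subset finV finite_subset by blast

lemma same_colour_ends: "\<lbrakk>e \<in> E; f \<in> E; e \<noteq> f; col e = col f\<rbrakk> \<Longrightarrow> ends e \<noteq> ends f"
  using simple by (auto simp: ec_simple_def)

lemma inj_on_ends_class: "inj_on ends (colour_class E col c)"
  using same_colour_ends by (auto simp: inj_on_def colour_class_def)

lemma other_edges:
  assumes "c \<in> col ` E"
  obtains f g where "f \<in> E" "g \<in> E" "col f = c" "col g = c" "f \<noteq> e" "g \<noteq> e" "f \<noteq> g"
proof -
  have "2 \<le> card (colour_class E col c - {e})"
    using class_ge[OF assms] card_Diff1_le[of "colour_class E col c" e]
    by (simp add: card_Diff_singleton_if) linarith
  then obtain S where "S \<subseteq> colour_class E col c - {e}" "card S = 2"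
    by (meson obtain_subset_with_card_n)
  then show thesis using that by (auto simp: card_2_iff colour_class_def)
qed

definition surplus :: "nat \<Rightarrow> 'v set \<Rightarrow> 'e set \<Rightarrow> bool" where
  "surplus s U A \<longleftrightarrow> U \<subseteq> V \<and> A \<subseteq> E \<and> inj_on col A \<and> (\<forall>e\<in>A. ends e \<subseteq> U) \<and> card U + s \<le> card A"

abbreviation deg :: "'e set \<Rightarrow> 'v \<Rightarrow> nat" where
  "deg A v \<equiv> card {e \<in> A. v \<in> ends e}"

lemma surplus_graph: "surplus s U A \<Longrightarrow> ec_graph U A ends"
  using ec_graph_subgraph[OF G] by (auto simp: surplus_def)

lemma cycle_in_rainbow:
  assumes "is_cycle U A ends vs es" "U \<subseteq> V" "A \<subseteq> E" "inj_on col A"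
  shows "4 * card V + 63 < 9 * length es"
proof (rule no_short)
  show "is_cycle V E ends vs es" using assms is_cycle_mono by blast
  have "distinct es" "set es \<subseteq> A" using assms(1) by (auto simp: is_cycle_def)
  then show "rainbow col es"
    using assms(4) unfolding rainbow_def by (simp add: distinct_map inj_on_subset)
qed

lemma surplus_nonempty:
  assumes "surplus s U A" "1 \<le> s"
  shows "U \<noteq> {}"
proof
  assume "U = {}"
  have "card A \<noteq> 0" using assms by (auto simp: surplus_def)
  then obtain e where "e \<in> A" by fastforce
  then have "ends e = {}" "e \<in> E" using assms \<open>U = {}\<close> by (auto simp: surplus_def)
  then show False using card_ends[of e] by simp
qed

text \<open>A set with surplus carries a rainbow cycle, which has more than 63/9 = 7 edges.\<close>

lemma surplus_card_ge:
  assumes "surplus s U A" "1 \<le> s"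
  shows "8 \<le> card U"
proof -
  obtain vs es where C: "is_cycle U A ends vs es"
    using cycle_if_card_le[OF surplus_graph[OF assms(1)] surplus_nonempty[OF assms]] assms(1)
    by (auto simp: surplus_def)
  have "finite U" using surplus_graph[OF assms(1)] by (simp add: ec_graph_def)
  then have "length es \<le> card U" using C is_cycle_length_le by blast
  moreover have "4 * card V + 63 < 9 * length es"
    using cycle_in_rainbow[OF C] assms(1) by (simp add: surplus_def)
  ultimately show ?thesis by linarith
qed

lemma surplus_exact:
  assumes "surplus s U A"
  obtains A' where "surplus s U A'" "card A' = card U + s"
proof -
  obtain A' where "A' \<subseteq> A" "card A' = card U + s"
    using assms obtain_subset_with_card_n by (metis surplus_def)
  then have "surplus s U A'" using assms unfolding surplus_def by (auto intro: inj_on_subset)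
  then show thesis using that \<open>card A' = card U + s\<close> by blast
qed

lemma transversal:
  assumes "\<And>c. c \<in> col ` E \<Longrightarrow> \<exists>f\<in>E. col f = c \<and> P f"
  obtains B where "B \<subseteq> E" "inj_on col B" "card B = card V" "col ` B = col ` E" "\<And>f. f \<in> B \<Longrightarrow> P f"
proof -
  obtain h where h: "\<And>c. c \<in> col ` E \<Longrightarrow> h c \<in> E \<and> col (h c) = c \<and> P (h c)"
    using assms by metis
  let ?B = "h ` col ` E"
  have "inj_on h (col ` E)" using h by (metis inj_onI)
  then have "card ?B = card V" using ncol by (simp add: card_image)
  moreover have "inj_on col ?B" using h by (auto simp: inj_on_def)
  moreover have "col ` ?B = col ` E" using h by (auto simp: image_iff)
  ultimately show thesis using that[of ?B] h by blast
qed

text \<open>A transversal that avoids \<open>X\<close> has \<open>card V\<close> edges on only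
  \<open>card V - card X\<close> vertices.\<close>

lemma surplus_of_avoiding:
  assumes "X \<subseteq> V" "\<And>c. c \<in> col ` E \<Longrightarrow> \<exists>f\<in>E. col f = c \<and> ends f \<inter> X = {}"
  shows "\<exists>A. surplus (card X) (V - X) A"
proof -
  obtain B where B: "B \<subseteq> E" "inj_on col B" "card B = card V" "\<And>f. f \<in> B \<Longrightarrow> ends f \<inter> X = {}"
    using transversal[of "\<lambda>f. ends f \<inter> X = {}"] assms(2) by metis
  have "card (V - X) + card X = card V" using finV assms(1) by (rule card_Diff_plus)
  then have "surplus (card X) (V - X) B"
    using B ends_subset unfolding surplus_def by fastforce
  then show ?thesis by blast
qed

end

section \<open>Exchange arguments in a minimal set with surplus\<close>

locale minimal_surplus = rainbow_counterexample V E ends col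
  for V :: "'v set" and E :: "'e set" and ends :: "'e \<Rightarrow> 'v set" and col :: "'e \<Rightarrow> 'c" +
  fixes s :: nat and U :: "'v set" and A :: "'e set"
  assumes S: "surplus s U A" and exact: "card A = card U + s"
    and s: "1 \<le> s" "s \<le> 2"
    and minimal: "\<And>a A'. a \<in> U \<Longrightarrow> \<not> surplus s (U - {a}) A'"
begin

lemma AE: "A \<subseteq> E" and UV: "U \<subseteq> V" and injA: "inj_on col A" and endsU: "\<And>e. e \<in> A \<Longrightarrow> ends e \<subseteq> U"
  using S by (auto simp: surplus_def)

lemma finU: "finite U" and finA: "finite A"
  using UV AE finV finE finite_subset by auto

text \<open>Deleting a vertex of degree at most 1 loses one vertex and at most one edge, which keeps
  the surplus and contradicts minimality.\<close>

lemma deg_ge_2: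
  assumes "v \<in> U"
  shows "2 \<le> deg A v"
proof (rule ccontr)
  assume *: "\<not> ?thesis"
  let ?A' = "A - {e \<in> A. v \<in> ends e}"
  have "card ?A' = card A - deg A v" using finA by (intro card_Diff_subset) auto
  moreover have "card (U - {v}) + 1 = card U" using card_Suc_Diff1[OF finU assms] by simp
  ultimately have "card (U - {v}) + s \<le> card ?A'" using * exact by linarith
  then have "surplus s (U - {v}) ?A'"
    using S endsU by (auto simp: surplus_def intro: inj_on_subset)
  then show False using minimal assms by blast
qed

text \<open>Deleting an end of such an edge costs one vertex and two edges of \<open>A\<close>, so a
  single inserted edge restores the surplus.\<close>

definition K :: "'e set" where
  "K = {e \<in> A. \<forall>v\<in>ends e. deg A v = 2}"

lemma sum_deg: "(\<Sum>v\<in>U. deg A v) = 2 * card A"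
proof -
  have "(\<Sum>v\<in>U. deg A v) = (\<Sum>e\<in>A. card (ends e \<inter> U))" using sum_degrees finU finA by blast
  also have "\<dots> = (\<Sum>e\<in>A. 2)" using endsU AE card_ends by (intro sum.cong) (auto simp: Int_absorb2)
  finally show ?thesis by simp
qed

text \<open>The excess \<open>deg A v - 2\<close> sums to
  \<open>2 * card A - 2 * card U = 2 * s\<close>. Each vertex of \<open>Br\<close> has excess at
  least 1, so there are at most \<open>2 * s\<close> of them, and their degrees sum to at most
  \<open>2 * s + 2 * (2 * s)\<close>.\<close>

lemma branch_bounds:
  defines "Br \<equiv> {v \<in> U. deg A v \<noteq> 2}"
  shows "card Br \<le> 2 * s" "card (A - K) \<le> 6 * s"
proof -
  have finBr: "finite Br" "Br \<subseteq> U" using finU by (auto simp: Br_def)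
  have ge: "3 \<le> deg A v" if "v \<in> Br" for v using that deg_ge_2[of v] by (auto simp: Br_def)
  have "(\<Sum>v\<in>U. deg A v - 2) + (\<Sum>v\<in>U. 2) = (\<Sum>v\<in>U. deg A v)"
    unfolding sum.distrib[symmetric] using deg_ge_2 by (intro sum.cong le_add_diff_inverse2) auto
  then have "(\<Sum>v\<in>U. deg A v - 2) = 2 * s" using sum_deg exact by simp
  moreover have "(\<Sum>v\<in>Br. deg A v - 2) \<le> (\<Sum>v\<in>U. deg A v - 2)"
    using finU finBr by (intro sum_mono2) auto
  ultimately have le: "(\<Sum>v\<in>Br. deg A v - 2) \<le> 2 * s" by simp
  have "(\<Sum>v\<in>Br. 1) \<le> (\<Sum>v\<in>Br. deg A v - 2)" using ge by (intro sum_mono) force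
  then show cBr: "card Br \<le> 2 * s" using le by simp
  have "A - K \<subseteq> {e \<in> A. ends e \<inter> Br \<noteq> {}}" using endsU by (auto simp: K_def Br_def)
  then have "card (A - K) \<le> card {e \<in> A. ends e \<inter> Br \<noteq> {}}" using finA by (intro card_mono) auto
  also have "\<dots> \<le> (\<Sum>v\<in>Br. deg A v)" using finBr finA by (intro card_edges_meeting_le)
  also have "\<dots> = (\<Sum>v\<in>Br. deg A v - 2) + (\<Sum>v\<in>Br. 2)"
    unfolding sum.distrib[symmetric] using ge deg_ge_2 finBr
    by (intro sum.cong le_add_diff_inverse2[symmetric]) auto
  also have "\<dots> \<le> 6 * s" using le cBr by simp
  finally show "card (A - K) \<le> 6 * s" .
qed

text \<open>Exchanging the two edges at \<open>a\<close> for \<open>f\<close> loses one edge and one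
  vertex; the colour condition keeps the edge set rainbow.\<close>

lemma no_swap:
  assumes a: "a \<in> U" "deg A a = 2" and f: "f \<in> E" "ends f \<subseteq> U" "a \<notin> ends f"
    and col: "col f \<notin> col ` (A - {e \<in> A. a \<in> ends e})"
  shows False
proof -
  let ?A' = "A - {e \<in> A. a \<in> ends e}"
  have "card ?A' = card A - 2" using finA a by (subst card_Diff_subset) auto
  moreover have "card A \<ge> 2" using card_mono[of A "{e \<in> A. a \<in> ends e}"] finA a by auto
  moreover have "f \<notin> ?A'" using col by blast
  ultimately have "card (insert f ?A') + 1 = card A" using finA by simp
  moreover have "card (U - {a}) + 1 = card U" using card_Suc_Diff1[OF finU a(1)] by simp
  ultimately have "card (U - {a}) + s \<le> card (insert f ?A')" using exact by linarith
  moreover have "inj_on col (insert f ?A')"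
    using inj_on_subset[OF injA, of ?A'] col unfolding inj_on_insert by blast
  ultimately have "surplus s (U - {a}) (insert f ?A')"
    using S f endsU by (auto simp: surplus_def)
  then show False using minimal a by blast
qed

text \<open>If an edge \<open>e\<close> of \<open>A\<close> has the colour of \<open>f\<close>, then
  \<open>e\<close> is in \<open>K\<close>, and by simplicity some end of \<open>e\<close> is not on
  \<open>f\<close>; deleting that end frees the colour. If the colour is absent from
  \<open>A\<close>, any vertex of degree 2 off \<open>f\<close> will do: at most
  \<open>2 * s + 2\<close>, hence at most 6, of the at least 8 vertices of \<open>U\<close> are
  excluded.\<close>

lemma new_edge_leaves_U:
  assumes f: "f \<in> E" "f \<notin> A" "col f \<notin> col ` (A - K)"
  shows "\<not> ends f \<subseteq> U"
proof
  assume fU: "ends f \<subseteq> U"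
  show False
  proof (cases "col f \<in> col ` A")
    case True
    then obtain e where e: "e \<in> A" "col e = col f" by auto
    have "e \<in> K" using e f(3) by (metis DiffI imageI)
    have "e \<noteq> f" "e \<in> E" using e f AE by auto
    have "\<not> ends e \<subseteq> ends f"
    proof
      assume "ends e \<subseteq> ends f"
      then have "ends e = ends f"
        using card_ends[OF \<open>e \<in> E\<close>] card_ends[OF f(1)] fin_ends[OF f(1)] by (metis card_subset_eq)
      then show False using same_colour_ends \<open>e \<in> E\<close> f(1) \<open>e \<noteq> f\<close> e by blast
    qed
    then obtain a where a: "a \<in> ends e" "a \<notin> ends f" by blast
    have "col f \<notin> col ` (A - {e \<in> A. a \<in> ends e})"
    proof
      assume "col f \<in> col ` (A - {e \<in> A. a \<in> ends e})"
      then obtain h where "h \<in> A - {e \<in> A. a \<in> ends e}" "col f = col h" by blast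
      then have "h \<in> A" "a \<notin> ends h" "col h = col e" using e by auto
      then show False using inj_onD[OF injA, of h e] e a by auto
    qed
    then show False using no_swap[of a f] a \<open>e \<in> K\<close> endsU[OF e(1)] f(1) fU unfolding K_def by blast
  next
    case False
    let ?Br = "{v \<in> U. deg A v \<noteq> 2}"
    have "card (?Br \<union> ends f) \<le> 2 * s + 2"
      using branch_bounds(1) card_ends[OF f(1)] card_Un_le[of ?Br "ends f"] by linarith
    then have "card (?Br \<union> ends f) < card U" using surplus_card_ge[OF S s(1)] s by linarith
    then have "\<not> U \<subseteq> ?Br \<union> ends f"
      using card_mono[of "?Br \<union> ends f" U] finU fin_ends[OF f(1)] by auto
    then obtain a where "a \<in> U" "deg A a = 2" "a \<notin> ends f" by blast
    then show False using no_swap[of a f] f fU False by blast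
  qed
qed

end


section \<open>Excluding surplus 2\<close>

context rainbow_counterexample
begin

lemma no_surplus_2: "\<not> surplus 2 U A"
proof
  assume "surplus 2 U A"
  then have "\<exists>p. surplus 2 (fst p) (snd p)" by auto
  then obtain p where p: "surplus 2 (fst p) (snd p)"
    and pmin: "\<forall>q. surplus 2 (fst q) (snd q) \<longrightarrow> card (fst p) \<le> card (fst q)"
    using ex_has_least_nat[of "\<lambda>p. surplus 2 (fst p) (snd p)" _ "\<lambda>p. card (fst p)"] by metis
  define U where "U = fst p"
  obtain A where A: "surplus 2 U A" "card A = card U + 2"
    using surplus_exact[OF p] by (auto simp: U_def)
  have UV: "U \<subseteq> V" and finU: "finite U" using A(1) finV finite_subset by (auto simp: surplus_def)
  interpret minimal_surplus V E ends col 2 U A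
  proof unfold_locales
    fix a A' assume "a \<in> U"
    then have "card (U - {a}) < card U" using finU by (intro card_Diff1_less)
    then show "\<not> surplus 2 (U - {a}) A'" using pmin by (metis U_def fst_conv snd_conv not_le)
  qed (use A in auto)
  obtain B where B: "B \<subseteq> E" "inj_on col B" "card B = card V"
    "\<And>f. f \<in> B \<Longrightarrow> f \<in> A - K \<or> \<not> ends f \<subseteq> U"
  proof (rule transversal[of "\<lambda>f. f \<in> A - K \<or> \<not> ends f \<subseteq> U"])
    fix c assume c: "c \<in> col ` E"
    show "\<exists>f\<in>E. col f = c \<and> (f \<in> A - K \<or> \<not> ends f \<subseteq> U)"
    proof (cases "c \<in> col ` (A - K)")
      case True
      then show ?thesis using AE by blast
    next
      case False
      \<comment> \<open>Of two edges of colour \<open>c\<close> at most one lies in the rainbow set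
        \<open>A\<close>; the other one leaves \<open>U\<close>.\<close>
      obtain f g where fg: "f \<in> E" "g \<in> E" "col f = c" "col g = c" "f \<noteq> g"
        using other_edges[OF c] by metis
      then have "f \<notin> A \<or> g \<notin> A" using inj_onD[OF injA, of f g] by auto
      then obtain h where "h \<in> E" "col h = c" "h \<notin> A" using fg by blast
      then show ?thesis using False new_edge_leaves_U[of h] by auto
    qed
  qed blast
  have GB: "ec_graph V B ends" using ec_graph_subgraph[OF G] B(1) ends_subset by blast
  obtain vs es where C: "is_cycle V B ends vs es" using cycle_if_card_le[OF GB ne] B(3) by auto
  have "length es \<le> card (A - K) + 2 * card (V - U)"
  proof (rule cycle_length_le_cover[OF C])
    fix e assume "e \<in> set es"
    then have "e \<in> B" using C by (auto simp: is_cycle_def)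
    then show "e \<in> A - K \<or> ends e \<inter> (V - U) \<noteq> {}" using B(4)[of e] B(1) ends_subset[of e] by blast
  qed (use finA finV in auto)
  moreover have "card (V - U) + card U = card V" using finV UV by (rule card_Diff_plus)
  moreover have "card (A - K) \<le> 12" using branch_bounds(2) by simp
  moreover have "4 * card V + 63 < 9 * length es" using cycle_in_rainbow[OF C] B by blast
  moreover obtain us hs where D: "is_cycle U A ends us hs" "7 * length hs \<le> 4 * (card U + 2)"
    using short_cycle_surplus_2[OF surplus_graph[OF A(1)] surplus_nonempty[OF A(1)]] A by auto
  moreover have "4 * card V + 63 < 9 * length hs" using cycle_in_rainbow[OF D(1) UV AE injA] .
  \<comment> \<open>The cycle in \<open>B\<close> gives
    \<open>18 * card U < 14 * card V + 45\<close>, the cycle in \<open>A\<close> gives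
    \<open>28 * card V + 369 < 36 * card U\<close>; doubling the first contradicts the
    second.\<close>
  ultimately show False by simp
qed

section \<open>Colour classes that are stars and those that are not\<close>

definition undominating :: "'v set" where
  "undominating = {v \<in> V. \<forall>c\<in>col ` E. \<exists>f\<in>E. col f = c \<and> v \<notin> ends f}"

definition nonstars :: "'c set" where
  "nonstars = {c \<in> col ` E. \<forall>v\<in>V. \<exists>f\<in>E. col f = c \<and> v \<notin> ends f}"

text \<open>By simplicity the edges of one colour, at least three, have pairwise different sets of
  ends.\<close>

lemma class_not_in_pair:
  assumes "c \<in> col ` E" "\<And>f. f \<in> E \<Longrightarrow> col f = c \<Longrightarrow> ends f \<in> {P, Q}"
  shows False
proof -
  have "card (colour_class E col c) \<le> card {P, Q}"
    using assms(2) by (intro card_inj_on_le[OF inj_on_ends_class]) (auto simp: colour_class_def)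
  moreover have "card {P, Q} \<le> 2" by (simp add: card_insert_if)
  ultimately show False using class_ge[OF assms(1)] by linarith
qed

lemma ends_eq_pair:
  assumes "f \<in> E" "u \<in> ends f" "v \<in> ends f" "u \<noteq> v"
  shows "ends f = {u, v}"
  using assms card_ends[OF assms(1)] by (auto simp: card_2_iff)

lemma dominator_unique:
  assumes "c \<in> col ` E" "\<And>f. f \<in> E \<Longrightarrow> col f = c \<Longrightarrow> u \<in> ends f \<and> v \<in> ends f"
  shows "u = v"
proof (rule ccontr)
  assume "u \<noteq> v"
  then show False
    using class_not_in_pair[OF assms(1), of "{u, v}" "{u, v}"] assms(2) ends_eq_pair by blast
qed

text \<open>The choice is injective because a class with two common vertices would consist of
  parallel edges.\<close>

lemma obtain_dominated_colour:
  obtains dc where "\<And>v. v \<in> V - undominating \<Longrightarrow> dc v \<in> col ` E"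
    "\<And>v f. v \<in> V - undominating \<Longrightarrow> f \<in> E \<Longrightarrow> col f = dc v \<Longrightarrow> v \<in> ends f"
    "inj_on dc (V - undominating)"
proof -
  have "\<forall>v\<in>V - undominating. \<exists>c\<in>col ` E. \<forall>f\<in>E. col f = c \<longrightarrow> v \<in> ends f"
    unfolding undominating_def by blast
  then obtain dc where dc: "\<forall>v\<in>V - undominating. dc v \<in> col ` E \<and> (\<forall>f\<in>E. col f = dc v \<longrightarrow> v \<in> ends f)"
    by metis
  then have "inj_on dc (V - undominating)"
    by (intro inj_onI) (metis dominator_unique)
  then show thesis using that dc by blast
qed

text \<open>The vertices outside \<open>undominating\<close> inject into the colours outside
  \<open>nonstars\<close>, and there are as many colours as vertices.\<close>

lemma card_nonstars_le: "card nonstars \<le> card undominating"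
proof -
  obtain dc where dc: "\<And>v. v \<in> V - undominating \<Longrightarrow> dc v \<in> col ` E"
    "\<And>v f. v \<in> V - undominating \<Longrightarrow> f \<in> E \<Longrightarrow> col f = dc v \<Longrightarrow> v \<in> ends f"
    "inj_on dc (V - undominating)"
    using obtain_dominated_colour by blast
  have "dc ` (V - undominating) \<subseteq> col ` E - nonstars"
  proof (intro image_subsetI DiffI)
    fix v assume v: "v \<in> V - undominating"
    then show "dc v \<in> col ` E" by (rule dc(1))
    show "dc v \<notin> nonstars" using dc(2)[OF v] v by (auto simp: nonstars_def)
  qed
  then have "card (V - undominating) \<le> card (col ` E - nonstars)"
    using dc(3) finE by (metis card_image card_mono finite_Diff finite_imageI)
  moreover have "card (V - undominating) + card undominating = card V"
    using finV by (intro card_Diff_plus) (auto simp: undominating_def)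
  moreover have "card (col ` E - nonstars) + card nonstars = card (col ` E)"
    using finE by (intro card_Diff_plus) (auto simp: nonstars_def)
  ultimately show ?thesis using ncol by linarith
qed

definition two_covers :: "'c \<Rightarrow> ('v \<times> 'v) set" where
  "two_covers c = {(u, v). \<forall>f\<in>E. col f = c \<longrightarrow> u \<in> ends f \<or> v \<in> ends f}"

text \<open>A cover contains an end \<open>a\<close> or \<open>b\<close> of a fixed edge of the
  class. The class is not a star, so some edge misses \<open>a\<close>, and a cover through
  \<open>a\<close> has one of its two ends as other member; likewise for \<open>b\<close>. This
  leaves four pairs, each in two orders.\<close>

lemma card_two_covers:
  assumes "c \<in> nonstars"
  shows "finite (two_covers c) \<and> card (two_covers c) \<le> 8"
proof -
  obtain f where f: "f \<in> E" "col f = c" using assms by (auto simp: nonstars_def)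
  obtain a b where ab: "ends f = {a, b}" using card_ends[OF f(1)] by (auto simp: card_2_iff)
  then have "a \<in> V" "b \<in> V" using ends_subset[OF f(1)] by auto
  moreover have "\<forall>v\<in>V. \<exists>f\<in>E. col f = c \<and> v \<notin> ends f" using assms by (simp add: nonstars_def)
  ultimately obtain g h where g: "g \<in> E" "col g = c" "a \<notin> ends g"
    and h: "h \<in> E" "col h = c" "b \<notin> ends h"
    by metis
  obtain x y where xy: "ends g = {x, y}" using card_ends[OF g(1)] by (auto simp: card_2_iff)
  obtain z w where zw: "ends h = {z, w}" using card_ends[OF h(1)] by (auto simp: card_2_iff)
  let ?P = "[(a, x), (a, y), (b, z), (b, w), (x, a), (y, a), (z, b), (w, b)]"
  have "two_covers c \<subseteq> set ?P"
  proof
    fix p assume "p \<in> two_covers c"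
    then obtain u v where uv: "p = (u, v)" "u \<in> ends f \<or> v \<in> ends f" "u \<in> ends g \<or> v \<in> ends g"
      "u \<in> ends h \<or> v \<in> ends h"
      using f g h by (auto simp: two_covers_def)
    then show "p \<in> set ?P" using ab xy zw g(3) h(3) by auto
  qed
  then have "finite (two_covers c)" "card (two_covers c) \<le> card (set ?P)"
    using finite_subset card_mono by blast+
  moreover have "card (set ?P) \<le> 8" using card_length[of ?P] by simp
  ultimately show ?thesis by linarith
qed

text \<open>Two distinct undominating vertices cover some class, for otherwise a transversal
  avoiding both would have surplus 2, and this class is not a star. With w undominating vertices,
  w(w - 1) is at most 8 times the number of nonstars, hence at most 8w, so w is at most 9.\<close>

lemma card_nonstars: "card nonstars \<le> 9"
proof -
  let ?W = "undominating"
  have W: "?W \<subseteq> V" "finite ?W" using finV by (auto simp: undominating_def)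
  have finN: "finite nonstars" using finE by (simp add: nonstars_def)
  have "?W \<times> ?W - Id_on ?W \<subseteq> (\<Union>c\<in>nonstars. two_covers c)"
  proof
    fix p assume "p \<in> ?W \<times> ?W - Id_on ?W"
    then obtain u v where p: "p = (u, v)" and u: "u \<in> ?W" and v: "v \<in> ?W" and "u \<noteq> v" by blast
    have "\<exists>c\<in>col ` E. \<forall>f\<in>E. col f = c \<longrightarrow> u \<in> ends f \<or> v \<in> ends f"
    proof (rule ccontr)
      assume "\<not> ?thesis"
      then have "\<exists>A. surplus (card {u, v}) (V - {u, v}) A"
        using u v W by (intro surplus_of_avoiding) auto
      moreover have "card {u, v} = 2" using \<open>u \<noteq> v\<close> by simp
      ultimately show False using no_surplus_2 by metis
    qed
    then obtain c where c: "c \<in> col ` E" and cov: "\<And>f. f \<in> E \<Longrightarrow> col f = c \<Longrightarrow> u \<in> ends f \<or> v \<in> ends f"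
      by blast
    have "\<exists>f\<in>E. col f = c \<and> w \<notin> ends f" if "w \<in> V" for w
    proof (rule ccontr)
      assume *: "\<not> ?thesis"
      \<comment> \<open>As \<open>u\<close> and \<open>v\<close> are undominating, a vertex
        \<open>w\<close> common to the whole class differs from both. Each edge then joins
        \<open>w\<close> to \<open>u\<close> or \<open>v\<close>, which allows only two
        edges.\<close>
      then have "w \<noteq> u" "w \<noteq> v" using u v c by (auto simp: undominating_def)
      then show False
        using class_not_in_pair[OF c, of "{w, u}" "{w, v}"] * cov ends_eq_pair by blast
    qed
    then have "c \<in> nonstars" using c by (auto simp: nonstars_def)
    moreover have "p \<in> two_covers c" using p cov by (auto simp: two_covers_def)
    ultimately show "p \<in> (\<Union>c\<in>nonstars. two_covers c)" by blast
  qed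
  then have "card (?W \<times> ?W - Id_on ?W) \<le> card (\<Union>c\<in>nonstars. two_covers c)"
    using finN card_two_covers by (intro card_mono) auto
  also have "\<dots> \<le> (\<Sum>c\<in>nonstars. card (two_covers c))" using finN by (rule card_UN_le)
  also have "\<dots> \<le> (\<Sum>c\<in>nonstars. 8)" using card_two_covers by (intro sum_mono) auto
  finally have "card (?W \<times> ?W - Id_on ?W) \<le> 8 * card ?W" using card_nonstars_le by simp
  moreover have "card (Id_on ?W) = card ?W"
  proof -
    have "Id_on ?W = (\<lambda>v. (v, v)) ` ?W" by auto
    then show ?thesis by (simp add: card_image inj_on_def)
  qed
  moreover have "card (?W \<times> ?W - Id_on ?W) + card (Id_on ?W) = card (?W \<times> ?W)"
    using W by (intro card_Diff_plus) auto
  ultimately have "card ?W * card ?W \<le> 9 * card ?W" unfolding card_cartesian_product by linarith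
  then have "card ?W \<le> 9" by (cases "card ?W = 0") auto
  then show ?thesis using card_nonstars_le by linarith
qed


section \<open>Excluding undominating vertices\<close>

lemma every_vertex_dominates: "undominating = {}"
proof (rule ccontr)
  assume "undominating \<noteq> {}"
  then obtain x where x: "x \<in> V" and xdom: "\<And>c. c \<in> col ` E \<Longrightarrow> \<exists>f\<in>E. col f = c \<and> x \<notin> ends f"
    by (auto simp: undominating_def)
  let ?P = "\<lambda>p. surplus 1 (fst p) (snd p) \<and> x \<notin> fst p"
  obtain A0 where "surplus (card {x}) (V - {x}) A0"
    using surplus_of_avoiding[of "{x}"] x xdom by auto
  then have "?P (V - {x}, A0)" by simp
  then obtain p where p: "?P p" and pmin: "\<forall>q. ?P q \<longrightarrow> card (fst p) \<le> card (fst q)"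
    using ex_has_least_nat[of ?P _ "\<lambda>p. card (fst p)"] by blast
  define U where "U = fst p"
  have xU: "x \<notin> U" and Umin: "\<And>U' A'. surplus 1 U' A' \<Longrightarrow> x \<notin> U' \<Longrightarrow> card U \<le> card U'"
    using p pmin by (auto simp: U_def)
  obtain A where A: "surplus 1 U A" "card A = card U + 1"
    using p surplus_exact[of 1 U] by (auto simp: U_def)
  have UVx: "U \<subseteq> V - {x}" and finU: "finite U"
    using A(1) xU finV finite_subset by (auto simp: surplus_def)
  \<comment> \<open>Minimality in the locale concerns only the deletion of one vertex, so a smallest
    set among those avoiding \<open>x\<close> qualifies.\<close>
  interpret minimal_surplus V E ends col 1 U A
  proof unfold_locales
    fix a A' assume "a \<in> U"
    then have "card (U - {a}) < card U" using finU by (intro card_Diff1_less)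
    then show "\<not> surplus 1 (U - {a}) A'" using Umin[of "U - {a}" A'] xU by auto
  qed (use A in auto)
  \<comment> \<open>\<open>K1\<close> consists of the edges of \<open>K\<close> that can be
    exchanged for another edge of their colour avoiding \<open>x\<close>.\<close>
  define K1 where "K1 = {e \<in> K. \<exists>f\<in>E. col f = col e \<and> f \<noteq> e \<and> x \<notin> ends f}"
  have KA: "K1 \<subseteq> K" "K \<subseteq> A" by (auto simp: K1_def K_def)
  have finK: "finite K" using KA(2) finA by (rule finite_subset)
  have finK1: "finite K1" using KA(1) finK by (rule finite_subset)

  \<comment> \<open>For \<open>e\<close> in \<open>K - K1\<close> all other edges of its colour
    contain \<open>x\<close>, while \<open>e\<close> does not. A vertex common to the class would
    differ from \<open>x\<close> and make two of those edges parallel.\<close>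
  have "col ` (K - K1) \<subseteq> nonstars"
  proof
    fix c assume "c \<in> col ` (K - K1)"
    then obtain e where e: "e \<in> K" "e \<notin> K1" "c = col e" by blast
    have eE: "e \<in> E" and eU: "ends e \<subseteq> U" using e KA AE endsU[of e] by auto
    obtain f g where fg: "f \<in> E" "g \<in> E" "col f = c" "col g = c" "f \<noteq> e" "g \<noteq> e" "f \<noteq> g"
      using other_edges[of c e] eE e(3) by blast
    have xfg: "x \<in> ends f" "x \<in> ends g" using e fg by (auto simp: K1_def)
    have "\<exists>f\<in>E. col f = c \<and> v \<notin> ends f" for v
    proof (rule ccontr)
      assume *: "\<not> ?thesis"
      then have "v \<in> ends e" "v \<in> ends f" "v \<in> ends g" using eE e fg by auto
      then have "v \<noteq> x" using eU xU by blast
      then have "ends f = ends g"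
        using ends_eq_pair fg(1,2) xfg \<open>v \<in> ends f\<close> \<open>v \<in> ends g\<close> by metis
      then show False using same_colour_ends fg by metis
    qed
    then show "c \<in> nonstars" using eE e by (auto simp: nonstars_def)
  qed
  moreover have "finite nonstars" using finE by (simp add: nonstars_def)
  moreover have "inj_on col (K - K1)" using injA KA by (meson Diff_subset inj_on_subset)
  ultimately have K2: "card (K - K1) \<le> 9"
    using card_nonstars by (metis card_image card_mono le_trans)

  let ?A1 = "A - K1"
  \<comment> \<open>\<open>B\<close> keeps the edges of \<open>A - K1\<close> and gives every other
    colour an edge that avoids \<open>x\<close> and leaves \<open>U\<close>.\<close>
  obtain B where B: "B \<subseteq> E" "inj_on col B" "card B = card V" "col ` B = col ` E"
    "\<And>f. f \<in> B \<Longrightarrow> x \<notin> ends f \<and> (if col f \<in> col ` ?A1 then f \<in> ?A1 else \<not> ends f \<subseteq> U)"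
  proof (rule transversal[of "\<lambda>f. x \<notin> ends f \<and> (if col f \<in> col ` ?A1 then f \<in> ?A1 else \<not> ends f \<subseteq> U)"])
    fix c assume c: "c \<in> col ` E"
    show "\<exists>f\<in>E. col f = c \<and> x \<notin> ends f \<and> (if col f \<in> col ` ?A1 then f \<in> ?A1 else \<not> ends f \<subseteq> U)"
    proof (cases "c \<in> col ` ?A1")
      case True
      then obtain f where "f \<in> ?A1" "col f = c" by blast
      moreover from this have "f \<in> E" "x \<notin> ends f" using AE endsU xU by auto
      ultimately show ?thesis using True by auto
    next
      case False
      have "\<exists>f\<in>E. col f = c \<and> x \<notin> ends f \<and> f \<notin> A"
      proof (cases "c \<in> col ` A")
        case True
        then obtain e where e: "e \<in> A" "col e = c" by blast
        then have "e \<in> K1" using False by blast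
        then obtain f where "f \<in> E" "col f = c" "f \<noteq> e" "x \<notin> ends f" using e by (auto simp: K1_def)
        moreover have "f \<notin> A" using inj_onD[OF injA, of f e] calculation e by auto
        ultimately show ?thesis by blast
      next
        case False
        then show ?thesis using xdom[OF c] by blast
      qed
      then obtain f where f: "f \<in> E" "col f = c" "x \<notin> ends f" "f \<notin> A" by blast
      have "col f \<notin> col ` (A - K)" using f False KA by blast
      then have "\<not> ends f \<subseteq> U" using new_edge_leaves_U f by blast
      then show ?thesis using f False by auto
    qed
  qed blast
  have finB: "finite B" using B(1) finE by (rule finite_subset)
  have BV: "ends f \<subseteq> V - {x}" if "f \<in> B" for f using that B(1,5) ends_subset by blast
  have A1B: "?A1 \<subseteq> B"
  proof
    fix e assume e: "e \<in> ?A1"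
    then have "col e \<in> col ` B" using AE B(4) by blast
    then obtain f where f: "f \<in> B" "col f = col e" by auto
    then have "f \<in> ?A1" using B(5)[OF f(1)] e by auto
    then have "f = e" using inj_onD[OF injA f(2)] e by auto
    then show "e \<in> B" using f by simp
  qed
  define New where "New = B - ?A1"
  have New: "\<not> ends f \<subseteq> U" if "f \<in> New" for f
  proof -
    have f: "f \<in> B" "f \<notin> ?A1" using that by (auto simp: New_def)
    then show ?thesis using B(5)[OF f(1)] by (auto split: if_splits)
  qed
  have cardNew: "card New + card A = card V + card K1"
  proof -
    have "card New + card ?A1 = card V"
      using card_Diff_plus[OF finB A1B] B(3) by (simp add: New_def)
    moreover have "card ?A1 + card K1 = card A" using KA finA by (intro card_Diff_plus) auto
    ultimately show ?thesis by linarith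
  qed

  \<comment> \<open>The degree count runs over the ends of \<open>K1\<close>: they have degree 2 in
    \<open>A\<close>, and passing to \<open>B\<close> removes \<open>K1\<close> and adds
    \<open>New\<close>.\<close>
  define M0 where "M0 = (\<Union>e\<in>K1. ends e)"
  have M0U: "M0 \<subseteq> U" using KA endsU by (auto simp: M0_def)
  have finM0: "finite M0" using M0U finU by (rule finite_subset)
  have degA: "deg A v = 2" if "v \<in> M0" for v using that by (auto simp: M0_def K1_def K_def)
  have split: "deg B v + deg K1 v = deg A v + deg New v" for v
  proof -
    have "{e \<in> B. v \<in> ends e} = {e \<in> ?A1. v \<in> ends e} \<union> {e \<in> New. v \<in> ends e}"
      using A1B by (auto simp: New_def)
    then have "deg B v = deg ?A1 v + deg New v"
      using finA finB by (simp add: card_Un_disjoint New_def disjoint_iff)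
    moreover have "{e \<in> A. v \<in> ends e} = {e \<in> ?A1. v \<in> ends e} \<union> {e \<in> K1. v \<in> ends e}"
      using KA by auto
    then have "deg A v = deg ?A1 v + deg K1 v"
      using finA finK1 by (simp add: card_Un_disjoint disjoint_iff)
    ultimately show ?thesis by simp
  qed
  have sumK1: "(\<Sum>v\<in>M0. deg K1 v) = 2 * card K1"
  proof -
    have "(\<Sum>v\<in>M0. deg K1 v) = (\<Sum>e\<in>K1. card (ends e \<inter> M0))"
      using sum_degrees finM0 finK1 by blast
    also have "\<dots> = (\<Sum>e\<in>K1. 2)"
    proof (rule sum.cong[OF refl])
      fix e assume e: "e \<in> K1"
      then have "ends e \<inter> M0 = ends e" by (auto simp: M0_def)
      then show "card (ends e \<inter> M0) = 2" using card_ends[of e] e KA AE by auto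
    qed
    finally show ?thesis by simp
  qed
  \<comment> \<open>An edge of \<open>New\<close> has an end outside \<open>U\<close>, hence at most
    one end in \<open>M0\<close>.\<close>
  have sumNew: "(\<Sum>v\<in>M0. deg New v) \<le> card New"
  proof -
    have "(\<Sum>v\<in>M0. deg New v) = (\<Sum>e\<in>New. card (ends e \<inter> M0))"
      using sum_degrees[OF finM0, of New ends] finB by (simp add: New_def)
    also have "\<dots> \<le> (\<Sum>e\<in>New. 1)"
    proof (rule sum_mono)
      fix e assume e: "e \<in> New"
      then have eE: "e \<in> E" using B(1) by (auto simp: New_def)
      have "ends e \<inter> M0 \<subset> ends e" using New[OF e] M0U by blast
      then have "card (ends e \<inter> M0) < card (ends e)" using fin_ends[OF eE] by (rule psubset_card_mono[rotated])
      then show "card (ends e \<inter> M0) \<le> 1" using card_ends[OF eE] by simp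
    qed
    finally show ?thesis by simp
  qed

  define Z where "Z = {v \<in> M0. deg B v \<le> 1}"
  have ZM0: "Z \<subseteq> M0" and finZ: "finite Z" using finM0 by (auto simp: Z_def)
  have ZV: "Z \<subseteq> V - {x}" using ZM0 M0U UVx by (meson subset_trans)
  \<comment> \<open>If \<open>B\<close> missed \<open>v\<close> as well as \<open>x\<close>, its
    \<open>card V\<close> edges would live on two vertices fewer, giving surplus 2.\<close>
  have degB: "1 \<le> deg B v" if "v \<in> V - {x}" for v
  proof (rule ccontr)
    assume "\<not> ?thesis"
    then have "deg B v = 0" by linarith
    then have "{e \<in> B. v \<in> ends e} = {}" using finB by auto
    then have "\<forall>f\<in>B. ends f \<subseteq> V - {x, v}" using BV by blast
    moreover have "card (V - {x, v}) + card {x, v} = card V"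
      using that x finV by (intro card_Diff_plus) auto
    ultimately have "surplus 2 (V - {x, v}) B" using B that by (auto simp: surplus_def)
    then show False using no_surplus_2 by blast
  qed
  \<comment> \<open>Deleting \<open>Z\<close> from \<open>V - {x}\<close> destroys at most
    \<open>card Z\<close> edges of \<open>B\<close>, so surplus 1 remains on a set avoiding
    \<open>x\<close>, and the choice of \<open>U\<close> applies.\<close>
  have "card U + 1 + card Z \<le> card V"
  proof -
    let ?D = "{e \<in> B. ends e \<inter> Z \<noteq> {}}"
    have "card ?D \<le> (\<Sum>v\<in>Z. deg B v)" using finZ finB by (rule card_edges_meeting_le)
    also have "\<dots> \<le> (\<Sum>v\<in>Z. 1)" by (intro sum_mono) (simp add: Z_def)
    finally have D: "card ?D \<le> card Z" by simp
    have cD: "card (B - ?D) + card ?D = card V" using finB B(3) card_Diff_plus[of B ?D] by auto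
    have cV: "card (V - insert x Z) + card (insert x Z) = card V"
      using x ZV finV by (intro card_Diff_plus) auto
    have cx: "card (insert x Z) = card Z + 1" using ZV finZ by (subst card_insert_disjoint) auto
    have "card (V - insert x Z) + 1 \<le> card (B - ?D)" using D cD cV cx by linarith
    moreover have "inj_on col (B - ?D)" using B(2) by (rule inj_on_subset) auto
    moreover have "\<forall>e\<in>B - ?D. ends e \<subseteq> V - insert x Z" using BV by blast
    ultimately have "surplus 1 (V - insert x Z) (B - ?D)" using B(1) by (auto simp: surplus_def)
    then have "card U \<le> card (V - insert x Z)" using Umin by blast
    then show ?thesis using cV cx by linarith
  qed
  moreover have "(\<Sum>v\<in>M0. 2) \<le> (\<Sum>v\<in>M0. deg B v) + card Z"
  proof -
    have "(\<Sum>v\<in>M0. 2) \<le> (\<Sum>v\<in>M0. deg B v + (if v \<in> Z then 1 else 0))"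
    proof (rule sum_mono)
      fix v assume v: "v \<in> M0"
      then have "1 \<le> deg B v" using degB[of v] M0U UVx by blast
      then show "2 \<le> deg B v + (if v \<in> Z then 1 else 0)" using v by (simp add: Z_def)
    qed
    also have "\<dots> = (\<Sum>v\<in>M0. deg B v) + card Z"
      using finM0 ZM0 by (simp add: sum.distrib sum.If_cases Int_absorb1)
    finally show ?thesis .
  qed
  moreover have "(\<Sum>v\<in>M0. deg B v) + 2 * card K1 = (\<Sum>v\<in>M0. 2) + (\<Sum>v\<in>M0. deg New v)"
  proof -
    have "(\<Sum>v\<in>M0. deg B v) + (\<Sum>v\<in>M0. deg K1 v) = (\<Sum>v\<in>M0. deg A v + deg New v)"
      unfolding sum.distrib[symmetric] using split by simp
    also have "\<dots> = (\<Sum>v\<in>M0. 2) + (\<Sum>v\<in>M0. deg New v)"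
      unfolding sum.distrib[symmetric] using degA by simp
    finally show ?thesis using sumK1 by simp
  qed
  \<comment> \<open>The degree count gives \<open>2 * card K1 \<le> card Z + card New\<close>. Here
    \<open>card New = card V + card K1 - card U - 1\<close> and
    \<open>card Z \<le> card V - card U - 1\<close>.\<close>
  ultimately have K1: "card K1 + 2 * card U + 2 \<le> 2 * card V"
    using sumNew cardNew exact by linarith

  have "card A = card (A - K) + card (K - K1) + card K1"
    using card_Diff_plus[OF finA KA(2)] card_Diff_plus[OF finK KA(1)] by linarith
  \<comment> \<open>The 12 is 6 + 9 - 2 - 1: at most 6 edges outside \<open>K\<close>, at most 9 in
    \<open>K - K1\<close>, the 2 from the bound on \<open>K1\<close>, and
    \<open>card A = card U + 1\<close>. The cycle in \<open>A\<close> then has 9 times its length at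
    most \<open>4 * card V + 30\<close>.\<close>
  then have "3 * card U \<le> 2 * card V + 12" using branch_bounds(2) K1 K2 exact by linarith
  moreover obtain us hs where D: "is_cycle U A ends us hs" "3 * length hs \<le> 2 * (card U + 1)"
    using short_cycle_surplus_1[OF surplus_graph[OF A(1)] surplus_nonempty[OF A(1)]] A by auto
  moreover have "4 * card V + 63 < 9 * length hs"
    using cycle_in_rainbow[OF D(1) UV AE injA] .
  ultimately show False by simp
qed

section \<open>Colour classes that are stars, one at each vertex\<close>

lemma no_counterexample: False
proof -
  obtain dc where dc: "\<And>v. v \<in> V \<Longrightarrow> dc v \<in> col ` E"
    "\<And>v f. v \<in> V \<Longrightarrow> f \<in> E \<Longrightarrow> col f = dc v \<Longrightarrow> v \<in> ends f"
    "inj_on dc V"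
    using obtain_dominated_colour unfolding every_vertex_dominates by auto
  \<comment> \<open>The class of colour \<open>dc v\<close> is a star centred at \<open>v\<close>;
    orienting its edges away from \<open>v\<close> yields a digraph, and by simplicity its
    out-degrees are at least 3.\<close>
  define M where "M v = {u. \<exists>f\<in>E. col f = dc v \<and> ends f = {v, u}}" for v
  have "3 \<le> card (M v)" if "v \<in> V" for v
  proof -
    have "\<exists>u\<in>M v. ends f = {v, u}" if f: "f \<in> colour_class E col (dc v)" for f
    proof -
      have fE: "f \<in> E" "col f = dc v" using f by (auto simp: colour_class_def)
      then have "v \<in> ends f" using dc(2) \<open>v \<in> V\<close> by blast
      then obtain u where "ends f = {v, u}" using card_ends[OF fE(1)] by (auto simp: card_2_iff doubleton_eq_iff)
      then show ?thesis using fE by (auto simp: M_def)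
    qed
    then have "ends ` colour_class E col (dc v) \<subseteq> (\<lambda>u. {v, u}) ` M v" by blast
    moreover have "M v \<subseteq> V" using ends_subset by (auto simp: M_def)
    then have finM: "finite (M v)" using finV finite_subset by blast
    ultimately have "card (ends ` colour_class E col (dc v)) \<le> card (M v)"
      by (meson card_image_le card_mono finite_imageI le_trans)
    then show ?thesis
      using class_ge[OF dc(1)[OF that]] inj_on_ends_class[of "dc v"] by (simp add: card_image)
  qed
  then have "\<forall>v\<in>V. \<exists>S. S \<subseteq> M v \<and> card S = 3" by (meson obtain_subset_with_card_n)
  then obtain N where N: "\<And>v. v \<in> V \<Longrightarrow> N v \<subseteq> M v \<and> card (N v) = 3" by metis
  have "M v \<subseteq> V" for v using ends_subset by (auto simp: M_def)
  then have "\<And>v. v \<in> V \<Longrightarrow> N v \<subseteq> V \<and> card (N v) = 3" using N by blast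
  then obtain k p where k: "1 \<le> k" "9 * k \<le> 4 * card V + 63" and inj: "inj_on p {..<k}"
    and pk: "p k = p 0" and p: "\<And>i. i < k \<Longrightarrow> p i \<in> V \<and> p (Suc i) \<in> N (p i)"
    using short_directed_cycle[of V N] finV ne by metis
  have "\<forall>i. \<exists>f. i < k \<longrightarrow> f \<in> E \<and> col f = dc (p i) \<and> ends f = {p i, p (Suc i)}"
    using p N unfolding M_def by blast
  then obtain e where e: "\<And>i. i < k \<Longrightarrow> e i \<in> E \<and> col (e i) = dc (p i) \<and> ends (e i) = {p i, p (Suc i)}"
    by metis
  \<comment> \<open>An arc has the colour assigned to its tail, and the tails on the cycle are
    distinct, so injectivity of \<open>dc\<close> makes the cycle rainbow.\<close>
  have injc: "inj_on (\<lambda>i. col (e i)) {..<k}"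
  proof (rule inj_onI)
    fix i j assume ij: "i \<in> {..<k}" "j \<in> {..<k}" "col (e i) = col (e j)"
    then have "dc (p i) = dc (p j)" using e by auto
    then have "p i = p j" using dc(3) p ij by (auto simp: inj_on_def)
    then show "i = j" using inj ij by (auto simp: inj_on_def)
  qed
  let ?vs = "map p [0..<k]" and ?es = "map e [0..<k]"
  have rb: "rainbow col ?es"
    using injc by (simp add: rainbow_def distinct_map comp_def atLeast0LessThan)
  have "is_cycle V E ends ?vs ?es"
    unfolding is_cycle_def
  proof (intro conjI allI impI)
    show "distinct ?vs" using inj by (simp add: distinct_map atLeast0LessThan)
    show "distinct ?es" using rb by (auto simp: rainbow_def distinct_map dest: inj_on_imageI2)
    fix i assume "i < length ?es"
    then have i: "i < k" by simp
    show "ends (?es ! i) = {?vs ! i, ?vs ! ((i + 1) mod length ?es)}"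
      using e[OF i] i pk by (cases "Suc i = k") auto
  qed (use k p e in auto)
  then show False using no_short rb k(2) by fastforce
qed

end

theorem theorem3p1:
  fixes V :: "'v set" and E :: "'e set" and ends :: "'e \<Rightarrow> 'v set"
    and col :: "'e \<Rightarrow> 'c" and n :: nat
  assumes "n \<ge> 1"
    and "ec_graph V E ends"
    and "ec_simple E ends col"
    and "card V = n"
    and "card (col ` E) = n"
    and "\<forall>c \<in> col ` E. card (colour_class E col c) \<ge> 3"
  shows "\<exists>vs es. is_cycle V E ends vs es \<and> rainbow col es \<and>
           real (length es) \<le> 4 * real n / 9 + 7"
proof (rule ccontr)
  assume none: "\<not> ?thesis"
  interpret rainbow_counterexample V E ends col
  proof
    show "V \<noteq> {}" using assms(1,4) by auto
    fix vs es assume "is_cycle V E ends vs es" "rainbow col es"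
    then have "4 * real n / 9 + 7 < real (length es)" using none by fastforce
    then have "real (4 * n + 63) < real (9 * length es)" by simp
    then show "4 * card V + 63 < 9 * length es" using assms(4) by linarith
  qed (use assms in auto)
  show False by (rule no_counterexample)
qed

end
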